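(* Let $d\ge 1$ be an integer, $\mathbb{D}_0=\mathbb{R}^d\times(0,\infty)$, and $K_t(\mathbf{x})=(4\pi t)^{-d/2}\exp\{-\|\mathbf{x}\|_2^2/(4t)\}$ for $\mathbf{x}\in\mathbb{R}^d$, $t>0$. Equip $\mathcal{C}_0=\mathcal{C}^{2,1}(\mathbb{D}_0)$ with the topology of uniform convergence on compacts of the function and its relevant partial derivatives of first and second order, and let $\mathcal{B}_{\mathcal{C}_0}$ be its Borel $\sigma$-algebra. There exists a $(\mathcal{C}_0,\mathcal{B}_{\mathcal{C}_0})$-valued, centered Gaussian field $\phi_d(\mathbf{x},t)$ with covariance function $$C\bigl((\mathbf{x}_1,t),(\mathbf{x}_2,s)\bigr)=K_{s+t}(\mathbf{x}_1-\mathbf{x}_2),$$ which satisfies the heat equation $$\frac{\partial\phi_d(\mathbf{x},t)}{\partial t}=\Delta\phi_d(\mathbf{x},t)$$ on $\mathbb{D}_0$. Further, $\phi_d\in\mathcal{C}^\infty(\mathbb{D}_0)$, and for any $0<t_1<t_2$ and $\mathbf{x}\in\mathbb{R}^d$, $$\phi_d(\mathbf{x},t_2)=\int_{\mathbb{R}^d}K_{t_2-t_1}(\mathbf{x}-\mathbf{y})\,\phi_d(\mathbf{y},t_1)\,d\mathbf{y}.$$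
   Context: $\mathcal{C}^{2,1}(\mathbb{D}_0)$ denotes the functions on $\mathbb{D}_0$ that are twice continuously differentiable in the space variable $\mathbf{x}$ and once continuously differentiable in the time variable $t$. $\Delta$ is the Laplacian in $\mathbf{x}$. *)

theory Defs
  imports "HOL-Probability.Probability"
begin

text \<open>Space-time is \<open>real^'n \<times> real\<close>, with \<open>d = CARD('n) \<ge> 1\<close>; the last component is time.\<close>

definition D0 :: "((real^'n) \<times> real) set"
  where "D0 = UNIV \<times> {0<..}"

definition heat_kernel :: "real \<Rightarrow> real^'n \<Rightarrow> real"
  where "heat_kernel t x =
    (4 * pi * t) powr (- (real CARD('n) / 2)) * exp (- ((norm x)\<^sup>2 / (4 * t)))"

subsection \<open>Partial derivatives and smoothness\<close>

definition has_partial :: "'a::real_normed_vector \<Rightarrow> ('a \<Rightarrow> real) \<Rightarrow> 'a \<Rightarrow> bool"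
  where "has_partial v f p \<longleftrightarrow> (\<lambda>h::real. f (p + h *\<^sub>R v)) field_differentiable (at 0)"

definition partial :: "'a::real_normed_vector \<Rightarrow> ('a \<Rightarrow> real) \<Rightarrow> 'a \<Rightarrow> real"
  where "partial v f p = deriv (\<lambda>h::real. f (p + h *\<^sub>R v)) 0"

text \<open>On an open set \<open>S\<close>: all partial derivatives up to order \<open>k\<close> exist and are continuous.\<close>

primrec Ck_on :: "nat \<Rightarrow> 'a::euclidean_space set \<Rightarrow> ('a \<Rightarrow> real) \<Rightarrow> bool"
  where
    "Ck_on 0 S f \<longleftrightarrow> continuous_on S f"
  | "Ck_on (Suc k) S f \<longleftrightarrow> continuous_on S f \<and>
       (\<forall>b\<in>Basis. (\<forall>p\<in>S. has_partial b f p) \<and> Ck_on k S (partial b f))"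

definition Cinf_on :: "'a::euclidean_space set \<Rightarrow> ('a \<Rightarrow> real) \<Rightarrow> bool"
  where "Cinf_on S f \<longleftrightarrow> (\<forall>k. Ck_on k S f)"

definition e_space :: "'n \<Rightarrow> (real^'n) \<times> real"
  where "e_space i = (axis i 1, 0)"

definition e_time :: "(real^'n) \<times> real"
  where "e_time = (0, 1)"

definition laplacian_x :: "((real^'n) \<times> real \<Rightarrow> real) \<Rightarrow> (real^'n) \<times> real \<Rightarrow> real"
  where "laplacian_x f p = (\<Sum>i\<in>UNIV. partial (e_space i) (partial (e_space i) f) p)"

subsection \<open>The space of \<open>C\<^sup>2\<^sup>,\<^sup>1\<close> functions on \<open>D0\<close>\<close>

text \<open>A function on \<open>D0\<close> is represented by a total function taking the value \<^term>\<open>undefined\<close>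
  outside \<open>D0\<close>, so that equality in \<open>C21\<close> is equality of functions on \<open>D0\<close>. Since \<open>D0\<close> is
  open, derivatives at its points do not depend on that convention.\<close>

definition C21 :: "((real^'n) \<times> real \<Rightarrow> real) set"
  where "C21 = {f \<in> extensional D0.
      continuous_on D0 f \<and>
      (\<forall>p\<in>D0. has_partial e_time f p) \<and> continuous_on D0 (partial e_time f) \<and>
      (\<forall>i. (\<forall>p\<in>D0. has_partial (e_space i) f p) \<and>
           continuous_on D0 (partial (e_space i) f)) \<and>
      (\<forall>i j. (\<forall>p\<in>D0. has_partial (e_space j) (partial (e_space i) f) p) \<and>
             continuous_on D0 (partial (e_space j) (partial (e_space i) f)))}"

definition C21_nbhd ::
    "((real^'n) \<times> real \<Rightarrow> real) \<Rightarrow> ((real^'n) \<times> real) set \<Rightarrow> real \<Rightarrow>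
     ((real^'n) \<times> real \<Rightarrow> real) set"
  where "C21_nbhd f K \<epsilon> = {g \<in> C21. \<forall>p\<in>K.
      \<bar>g p - f p\<bar> < \<epsilon> \<and>
      \<bar>partial e_time g p - partial e_time f p\<bar> < \<epsilon> \<and>
      (\<forall>i. \<bar>partial (e_space i) g p - partial (e_space i) f p\<bar> < \<epsilon>) \<and>
      (\<forall>i j. \<bar>partial (e_space j) (partial (e_space i) g) p
              - partial (e_space j) (partial (e_space i) f) p\<bar> < \<epsilon>)}"

text \<open>Uniform convergence on compacts of the function and its derivatives. The sets below are open
  in it, as continuous functions attain their maximum on the compact \<open>K\<close>.\<close>

definition C21_topology :: "((real^'n) \<times> real \<Rightarrow> real) topology"
  where "C21_topology = topology_generated_by
    {C21_nbhd f K \<epsilon> |f K \<epsilon>. f \<in> C21 \<and> compact K \<and> K \<subseteq> D0 \<and> 0 < \<epsilon>}"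

definition borel_of_topology :: "'a topology \<Rightarrow> 'a measure"
  where "borel_of_topology T = sigma (topspace T) {U. openin T U}"

lemma topspace_C21_topology: "topspace C21_topology = C21"
proof
  show "topspace C21_topology \<subseteq> C21"
    unfolding C21_topology_def topology_generated_by_topspace C21_nbhd_def by blast
  show "C21 \<subseteq> topspace C21_topology"
  proof
    fix f :: "(real^'n) \<times> real \<Rightarrow> real" assume f: "f \<in> C21"
    then have "f \<in> C21_nbhd f {} 1" by (simp add: C21_nbhd_def)
    moreover have "C21_nbhd f {} 1 \<in>
        {C21_nbhd f K \<epsilon> |f K \<epsilon>. f \<in> C21 \<and> compact K \<and> K \<subseteq> D0 \<and> 0 < \<epsilon>}"
      by (rule CollectI, intro exI conjI, rule refl) (use f in simp_all)
    ultimately show "f \<in> topspace C21_topology"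
      unfolding C21_topology_def topology_generated_by_topspace by (rule UnionI[rotated])
  qed
qed

lemma space_borel_C21: "space (borel_of_topology C21_topology) = C21"
  by (simp add: borel_of_topology_def topspace_C21_topology space_measure_of_conv)

subsection \<open>Gaussian fields\<close>

text \<open>Degenerate (constant) variables count as Gaussian.\<close>

definition gaussian_rv :: "'w measure \<Rightarrow> ('w \<Rightarrow> real) \<Rightarrow> bool"
  where "gaussian_rv M X \<longleftrightarrow> X \<in> borel_measurable M \<and>
    (\<exists>\<mu> \<sigma>. 0 \<le> \<sigma> \<and>
      distr M borel X =
        (if \<sigma> = 0 then return borel \<mu>
         else density lborel (\<lambda>x. ennreal (normal_density \<mu> \<sigma> x))))"

text \<open>All finite-dimensional distributions are Gaussian: every finite linear combination is.\<close>

definition gaussian_field :: "'w measure \<Rightarrow> 'i set \<Rightarrow> ('i \<Rightarrow> 'w \<Rightarrow> real) \<Rightarrow> bool"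
  where "gaussian_field M I X \<longleftrightarrow>
    (\<forall>F c. finite F \<longrightarrow> F \<subseteq> I \<longrightarrow> gaussian_rv M (\<lambda>w. \<Sum>i\<in>F. c i * X i w))"

definition centered_field :: "'w measure \<Rightarrow> 'i set \<Rightarrow> ('i \<Rightarrow> 'w \<Rightarrow> real) \<Rightarrow> bool"
  where "centered_field M I X \<longleftrightarrow> (\<forall>i\<in>I. integrable M (X i) \<and> (\<integral>w. X i w \<partial>M) = 0)"

definition covariance :: "'w measure \<Rightarrow> ('w \<Rightarrow> real) \<Rightarrow> ('w \<Rightarrow> real) \<Rightarrow> real"
  where "covariance M X Y =
    (\<integral>w. (X w - (\<integral>u. X u \<partial>M)) * (Y w - (\<integral>u. Y u \<partial>M)) \<partial>M)"

end

theory Submission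
  imports Defs
begin

text \<open>By the semigroup property of the heat kernel, the covariance \<open>K\<^bsub>s+t\<^esub>(x - y)\<close> is a Gram matrix in
  \<open>L\<^sup>2\<close>, hence positive semidefinite. Gaussian elimination along a dense sequence of points writes any such
  continuous kernel as \<open>C p q = (\<Sum>k. f k p * f k q)\<close> (\<open>psd_kernel_expansion\<close>), where each \<open>f k\<close> is a finite linear
  combination of functions \<open>\<lambda>p. C p q\<close>. So each \<open>f k\<close> is a solution of the heat equation on \<open>D0\<close>, carried from
  each time to all later times by convolution with the heat kernel. With independent standard normal \<open>\<xi> k\<close> the field
  is \<open>\<phi> p = (\<Sum>k. \<xi> k * f k p)\<close>.

  The variance of the tails of this series tends to zero pointwise and boundedly on each time slice. Grouping the series into
  sufficiently long blocks, the weighted \<open>L\<^sup>1\<close>-norms of the blocks on the slices at times \<open>1/1, 1/2, 1/3, \<dots>\<close> are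
  summable almost surely. Convolution with the heat kernel turns an \<open>L\<^sup>1\<close>-bound on a slice into a
  pointwise bound at later times (\<open>heat_evolution_series\<close>). So almost surely the series converges everywhere on \<open>D0\<close>
  and \<open>\<phi>\<close> at later times is the integral of a slice of \<open>\<phi>\<close> against the heat kernel. This one representation
  yields the path properties: differentiating under the integral
  sign gives smoothness and the heat equation (\<open>heat_represented_Ck_on\<close>, \<open>heat_represented_heat_equation\<close>), and Fubini
  gives the integral identity between any two times (\<open>heat_represented_semigroup\<close>). On the exceptional null set the field is
  put to zero.

  Finite combinations of values of \<open>\<phi>\<close> are almost sure limits of centered normal variables with converging
  variances, so they are centered normal (\<open>distr_field_combination\<close>); their variances determine the covariance by
  polarization. Finally, every open set of \<open>C21\<close> is a union of sets from one countable system, and each set of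
  this system is determined by countably many evaluations, so a map into \<open>C21\<close> is Borel measurable as soon as its evaluations are
  (\<open>measurable_borel_C21\<close>).\<close>

section \<open>Expansion of positive semidefinite kernels\<close>

text \<open>The points \<open>p i\<close> may repeat, which leaves room to append a point to a family that already
  contains it.\<close>

definition psd_kernel :: "'a set \<Rightarrow> ('a \<Rightarrow> 'a \<Rightarrow> real) \<Rightarrow> bool"
  where "psd_kernel S R \<longleftrightarrow> (\<forall>p\<in>S. \<forall>q\<in>S. R p q = R q p) \<and>
    (\<forall>(n::nat) c p. (\<forall>i<n. p i \<in> S) \<longrightarrow> 0 \<le> (\<Sum>i<n. \<Sum>j<n. c i * c j * R (p i) (p j)))"

lemma psd_kernel_commute: "psd_kernel S R \<Longrightarrow> p \<in> S \<Longrightarrow> q \<in> S \<Longrightarrow> R p q = R q p"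
  unfolding psd_kernel_def by blast

lemma psd_kernel_two_points:
  assumes R: "psd_kernel S R" and "p \<in> S" "q \<in> S"
  shows "0 \<le> R p p + 2 * \<mu> * R p q + \<mu>\<^sup>2 * R q q"
proof -
  let ?c = "\<lambda>i::nat. if i = 0 then 1 else \<mu>" and ?p = "\<lambda>i::nat. if i = 0 then p else q"
  have "0 \<le> (\<Sum>i<2. \<Sum>j<2. ?c i * ?c j * R (?p i) (?p j))"
    using conjunct2[OF R[unfolded psd_kernel_def], rule_format, of 2 ?p ?c] assms(2,3) by simp
  also have "\<dots> = R p p + 2 * \<mu> * R p q + \<mu>\<^sup>2 * R q q"
    using psd_kernel_commute[OF R assms(3,2)] by (simp add: numeral_2_eq_2 algebra_simps)
  finally show ?thesis .
qed

lemma psd_kernel_diag_nonneg: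
  assumes "psd_kernel S R" "p \<in> S"
  shows "0 \<le> R p p"
  using psd_kernel_two_points[OF assms(1,2,2), of 0] by simp

lemma psd_kernel_abs_le:
  assumes "psd_kernel S R" "p \<in> S" "q \<in> S"
  shows "2 * \<bar>R p q\<bar> \<le> R p p + R q q"
  using psd_kernel_two_points[OF assms, of 1] psd_kernel_two_points[OF assms, of "-1"]
  by (simp add: abs_if)

text \<open>Otherwise the nonnegative quadratic form at \<open>q + \<mu> p\<close> would be affine and nonconstant in \<open>\<mu>\<close>.\<close>

lemma psd_kernel_null:
  assumes R: "psd_kernel S R" "p \<in> S" "q \<in> S" and "R p p = 0"
  shows "R p q = 0"
proof (rule ccontr)
  assume ne: "R p q \<noteq> 0"
  \<comment> \<open>The quadratic form at this \<open>\<mu>\<close> has the value \<open>- 1\<close>.\<close>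
  define \<mu> where "\<mu> = - (R q q + 1) / (2 * R p q)"
  have "0 \<le> R q q + 2 * \<mu> * R q p + \<mu>\<^sup>2 * R p p"
    by (rule psd_kernel_two_points[OF R(1,3,2)])
  also have "\<dots> = - 1"
    using ne psd_kernel_commute[OF R] \<open>R p p = 0\<close> by (simp add: \<mu>_def field_simps)
  finally show False by simp
qed

definition schur :: "('a \<Rightarrow> 'a \<Rightarrow> real) \<Rightarrow> 'a \<Rightarrow> 'a \<Rightarrow> 'a \<Rightarrow> real"
  where "schur R a p q = R p q - R p a * R a q / R a a"

text \<open>Completing the square: the quadratic form of the Schur complement at coefficients \<open>c\<close> is the
  minimum over \<open>\<mu>\<close> of the quadratic form of \<open>R\<close> with the point \<open>a\<close> appended at coefficient
  \<open>\<mu>\<close>. If \<open>R a a = 0\<close>, then division by zero makes the Schur complement equal to \<open>R\<close>.\<close>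

lemma psd_kernel_schur:
  assumes R: "psd_kernel S R" and a: "a \<in> S"
  shows "psd_kernel S (schur R a)"
  unfolding psd_kernel_def
proof (intro conjI ballI allI impI)
  fix p q assume "p \<in> S" "q \<in> S"
  then show "schur R a p q = schur R a q p"
    using psd_kernel_commute[OF R] a by (simp add: schur_def)
next
  fix n :: nat and c p assume p: "\<forall>i<n. p i \<in> S"
  define Q where "Q = (\<Sum>i<n. \<Sum>j<n. c i * c j * R (p i) (p j))"
  define L where "L = (\<Sum>i<n. c i * R (p i) a)"
  have L': "L = (\<Sum>i<n. c i * R a (p i))"
    unfolding L_def using psd_kernel_commute[OF R _ a] p by (intro sum.cong) auto
  have "(\<Sum>i<n. \<Sum>j<n. c i * c j * schur R a (p i) (p j)) =
      Q - (\<Sum>i<n. \<Sum>j<n. (c i * R (p i) a) * (c j * R a (p j))) / R a a"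
    unfolding Q_def schur_def sum_divide_distrib sum_subtractf[symmetric]
    by (intro sum.cong refl) (simp add: field_simps)
  also have "(\<Sum>i<n. \<Sum>j<n. (c i * R (p i) a) * (c j * R a (p j))) = L * L"
    by (subst (2) L') (simp add: L_def sum_product)
  finally have eq: "(\<Sum>i<n. \<Sum>j<n. c i * c j * schur R a (p i) (p j)) = Q - L * L / R a a" .
  show "0 \<le> (\<Sum>i<n. \<Sum>j<n. c i * c j * schur R a (p i) (p j))"
  proof (cases "R a a = 0")
    case True
    have "0 \<le> Q" using R p unfolding psd_kernel_def Q_def by blast
    then show ?thesis using True eq by simp
  next
    case False
    define \<mu> where "\<mu> = - L / R a a"
    let ?c = "c(n := \<mu>)" and ?p = "p(n := a)"
    have "0 \<le> (\<Sum>i<Suc n. \<Sum>j<Suc n. ?c i * ?c j * R (?p i) (?p j))"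
    proof -
      have "\<forall>i<Suc n. ?p i \<in> S" using p a by (auto simp: less_Suc_eq)
      then show ?thesis using R unfolding psd_kernel_def by blast
    qed
    also have "\<dots> = Q + (\<Sum>i<n. c i * \<mu> * R (p i) a) + ((\<Sum>j<n. \<mu> * c j * R a (p j)) + \<mu> * \<mu> * R a a)"
      by (simp add: Q_def sum.distrib)
    also have "(\<Sum>i<n. c i * \<mu> * R (p i) a) = \<mu> * L"
      by (simp add: L_def sum_distrib_left algebra_simps)
    also have "(\<Sum>j<n. \<mu> * c j * R a (p j)) = \<mu> * L"
      by (simp add: L' sum_distrib_left algebra_simps)
    also have "Q + \<mu> * L + (\<mu> * L + \<mu> * \<mu> * R a a) = Q - L * L / R a a"
      using False by (simp add: \<mu>_def field_simps)
    finally show ?thesis using eq by simp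
  qed
qed

text \<open>Gaussian elimination on an infinite kernel: \<open>residual C a n\<close> is what remains of \<open>C\<close> after projecting
  away \<open>a 0, \<dots>, a (n - 1)\<close>, that is, the conditional covariance of a Gaussian field given its
  values at these points. The modes are the columns of the corresponding Cholesky factor. A vanishing
  pivot gives the zero mode, again by division by zero.\<close>

primrec residual :: "('a \<Rightarrow> 'a \<Rightarrow> real) \<Rightarrow> (nat \<Rightarrow> 'a) \<Rightarrow> nat \<Rightarrow> 'a \<Rightarrow> 'a \<Rightarrow> real"
  where
    "residual C a 0 = C"
  | "residual C a (Suc n) = schur (residual C a n) (a n)"

definition kernel_mode :: "('a \<Rightarrow> 'a \<Rightarrow> real) \<Rightarrow> (nat \<Rightarrow> 'a) \<Rightarrow> nat \<Rightarrow> 'a \<Rightarrow> real"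
  where "kernel_mode C a n p = residual C a n p (a n) / sqrt (residual C a n (a n) (a n))"

lemma psd_kernel_residual:
  assumes "psd_kernel S C" "range a \<subseteq> S"
  shows "psd_kernel S (residual C a n)"
  using assms by (induction n) (auto intro: psd_kernel_schur)

lemma residual_eq_diff_sum:
  assumes C: "psd_kernel S C" and a: "range a \<subseteq> S" and p: "p \<in> S" and q: "q \<in> S"
  shows "residual C a n p q = C p q - (\<Sum>k<n. kernel_mode C a k p * kernel_mode C a k q)"
proof (induction n)
  case (Suc n)
  let ?R = "residual C a n"
  note R = psd_kernel_residual[OF C a, of n]
  have an: "a n \<in> S" using a by auto
  have "?R p (a n) * ?R (a n) q / ?R (a n) (a n) = kernel_mode C a n p * kernel_mode C a n q"
    using psd_kernel_diag_nonneg[OF R an] psd_kernel_commute[OF R an q]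
    by (simp add: kernel_mode_def)
  then show ?case using Suc by (simp add: schur_def)
qed simp

text \<open>Elimination keeps the zero rows already produced; a new one appears at \<open>a n\<close>, trivially when the
  pivot is nonzero and by \<open>psd_kernel_null\<close> when it vanishes.\<close>

lemma residual_vanishes:
  assumes C: "psd_kernel S C" and a: "range a \<subseteq> S" and q: "q \<in> S" and "j < n"
  shows "residual C a n (a j) q = 0"
  using \<open>j < n\<close> q
proof (induction n arbitrary: q)
  case (Suc n)
  note R = psd_kernel_residual[OF C a, of n]
  have an: "a n \<in> S" using a by auto
  show ?case
  proof (cases "j = n")
    case True
    then show ?thesis using psd_kernel_null[OF R an Suc.prems(2)] by (auto simp: schur_def)
  next
    case False
    then have "j < n" using Suc.prems(1) by simp
    then show ?thesis using Suc.IH Suc.prems(2) an by (simp add: schur_def)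
  qed
qed simp

text \<open>The squared distance between \<open>p\<close> and \<open>q\<close> in the feature space of the kernel.\<close>

definition kernel_dist2 :: "('a \<Rightarrow> 'a \<Rightarrow> real) \<Rightarrow> 'a \<Rightarrow> 'a \<Rightarrow> real"
  where "kernel_dist2 R p q = R p p - 2 * R p q + R q q"

text \<open>A Schur complement subtracts the square \<open>(R p a - R q a)\<^sup>2 / R a a\<close> from the squared
  distance: in the feature space of \<open>R\<close> it is an orthogonal projection, hence a contraction.\<close>

lemma kernel_dist2_schur_le:
  assumes R: "psd_kernel S R" and "a \<in> S" "p \<in> S" "q \<in> S"
  shows "kernel_dist2 (schur R a) p q \<le> kernel_dist2 R p q"
proof -
  have "kernel_dist2 (schur R a) p q = kernel_dist2 R p q - (R p a - R q a)\<^sup>2 / R a a"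
    using psd_kernel_commute[OF R assms(2,3)] psd_kernel_commute[OF R assms(2,4)]
    by (simp add: kernel_dist2_def schur_def power2_eq_square diff_divide_distrib add_divide_distrib
        algebra_simps)
  then show ?thesis using psd_kernel_diag_nonneg[OF R assms(2)] by simp
qed

lemma kernel_dist2_residual_le:
  assumes C: "psd_kernel S C" and a: "range a \<subseteq> S" and "p \<in> S" "q \<in> S"
  shows "kernel_dist2 (residual C a n) p q \<le> kernel_dist2 C p q"
proof (induction n)
  case (Suc n)
  have "a n \<in> S" using a by auto
  from kernel_dist2_schur_le[OF psd_kernel_residual[OF C a, of n] this assms(3,4)] Suc
  show ?case by simp
qed simp

text \<open>Once \<open>a j\<close> has been projected away, the residual variance at \<open>p\<close> is the residual distance
  from \<open>p\<close> to \<open>a j\<close>, which is at most the original one. So it tends to zero as soon as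
  the points \<open>a j\<close> are dense for the distance of the kernel.\<close>

theorem psd_kernel_expansion:
  assumes C: "psd_kernel S C" and a: "range a \<subseteq> S"
    and dense: "\<And>p e. p \<in> S \<Longrightarrow> 0 < e \<Longrightarrow> \<exists>j. kernel_dist2 C p (a j) < e"
    and p: "p \<in> S" and q: "q \<in> S"
  shows "(\<lambda>k. kernel_mode C a k p * kernel_mode C a k q) sums C p q"
proof -
  have diag: "(\<lambda>n. residual C a n p p) \<longlonglongrightarrow> 0" if p: "p \<in> S" for p
  proof (rule LIMSEQ_I)
    fix e :: real assume "0 < e"
    then obtain j where j: "kernel_dist2 C p (a j) < e" using dense p by blast
    have "norm (residual C a n p p - 0) < e" if "n \<ge> Suc j" for n
    proof -
      note R = psd_kernel_residual[OF C a, of n]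
      have aj: "a j \<in> S" using a by auto
      have 0: "residual C a n (a j) r = 0" if "r \<in> S" for r
        using residual_vanishes[OF C a that] \<open>n \<ge> Suc j\<close> by simp
      have "residual C a n p p = kernel_dist2 (residual C a n) p (a j)"
        using 0[OF aj] 0[OF p] psd_kernel_commute[OF R p aj] by (simp add: kernel_dist2_def)
      also have "\<dots> < e" using kernel_dist2_residual_le[OF C a p aj, of n] j by linarith
      finally show ?thesis using psd_kernel_diag_nonneg[OF R p] by simp
    qed
    then show "\<exists>no. \<forall>n\<ge>no. norm (residual C a n p p - 0) < e" by blast
  qed
  have lim: "(\<lambda>n. residual C a n p q) \<longlonglongrightarrow> 0"
  proof (rule Lim_null_comparison)
    show "\<forall>\<^sub>F n in sequentially. norm (residual C a n p q)
        \<le> (residual C a n p p + residual C a n q q) / 2"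
      using psd_kernel_abs_le[OF psd_kernel_residual[OF C a] p q] by (simp add: field_simps)
    show "(\<lambda>n. (residual C a n p p + residual C a n q q) / 2) \<longlonglongrightarrow> 0"
      using tendsto_divide[OF tendsto_add[OF diag[OF p] diag[OF q]] tendsto_const[of 2]] by simp
  qed
  have "(\<Sum>k<n. kernel_mode C a k p * kernel_mode C a k q) = C p q - residual C a n p q" for n
    using residual_eq_diff_sum[OF C a p q, of n] by simp
  with tendsto_diff[OF tendsto_const[of "C p q"] lim] show ?thesis
    unfolding sums_def by simp
qed

text \<open>Each mode is a finite linear combination of the functions \<open>\<lambda>p. C p q\<close>, so it lies in every
  linear space that contains all of them.\<close>

lemma kernel_mode_in_span:
  assumes C: "\<And>q. q \<in> S \<Longrightarrow> P (\<lambda>p. C p q)"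
    and comb: "\<And>u v c d. P u \<Longrightarrow> P v \<Longrightarrow> P (\<lambda>p. c * u p + d * v p)"
    and a: "range a \<subseteq> S"
  shows "P (kernel_mode C a n)"
proof -
  have an: "a n \<in> S" for n using a by auto
  have R: "P (\<lambda>p. residual C a n p q)" if "q \<in> S" for n q
    using that
  proof (induction n arbitrary: q)
    case (Suc n)
    from comb[OF Suc.IH[OF Suc.prems] Suc.IH[OF an], of 1
        "- (residual C a n (a n) q / residual C a n (a n) (a n))"]
    show ?case by (simp add: schur_def algebra_simps)
  qed (simp add: C)
  have "kernel_mode C a n = (\<lambda>p. residual C a n p (a n) / sqrt (residual C a n (a n) (a n)))"
    by (rule ext) (simp add: kernel_mode_def)
  then show ?thesis
    using comb[OF R[OF an] R[OF an], of "1 / sqrt (residual C a n (a n) (a n))" n n 0 n n] by simp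
qed

section \<open>The heat kernel\<close>

lemma Basis_vec_eq_range_axis: "(Basis :: (real^'n) set) = range (\<lambda>i. axis i 1)"
  by (auto simp: Basis_vec_def)

lemma nn_integral_lborel_vec:
  fixes f :: "'n::finite \<Rightarrow> real \<Rightarrow> ennreal"
  assumes [measurable]: "\<And>i. f i \<in> borel_measurable borel"
  shows "(\<integral>\<^sup>+x. (\<Prod>i\<in>UNIV. f i (x $ i)) \<partial>(lborel :: (real^'n) measure)) = (\<Prod>i\<in>UNIV. \<integral>\<^sup>+u. f i u \<partial>lborel)"
proof -
  have inj: "inj (\<lambda>i::'n. axis i (1::real))" by (auto simp: inj_on_def axis_eq_axis)
  have "(\<integral>\<^sup>+x. (\<Prod>b\<in>Basis. f (axis_index b) (x \<bullet> b)) \<partial>(lborel :: (real^'n) measure))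
      = (\<Prod>b\<in>(Basis::(real^'n) set). \<integral>\<^sup>+u. f (axis_index b) u \<partial>lborel)"
    by (rule nn_integral_lborel_prod) auto
  then show ?thesis
    unfolding Basis_vec_eq_range_axis
    by (simp add: prod.reindex[OF inj] axis_index_axis inner_axis)
qed

lemma heat_kernel_nonneg [simp]: "0 \<le> heat_kernel t x"
  by (simp add: heat_kernel_def)

lemma heat_kernel_minus [simp]: "heat_kernel t (- x) = heat_kernel t x"
  by (simp add: heat_kernel_def)

lemma heat_kernel_swap: "heat_kernel t (x - y) = heat_kernel t (y - x)"
  by (metis heat_kernel_minus minus_diff_eq)

lemma measurable_heat_kernel [measurable]:
  "(heat_kernel t :: real^'n \<Rightarrow> real) \<in> borel_measurable borel"
  unfolding heat_kernel_def[abs_def] by measurable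

text \<open>In coordinates the kernel is a product of centered normal densities of variance \<open>2 t\<close>; its convolution
  semigroup property is thereby that of one-dimensional normal densities.\<close>

lemma heat_kernel_eq_prod:
  fixes x :: "real^'n"
  assumes "0 < t"
  shows "heat_kernel t x = (\<Prod>i\<in>UNIV. normal_density 0 (sqrt (2 * t)) (x $ i))"
proof -
  have "(norm x)\<^sup>2 = (\<Sum>i\<in>UNIV. (x $ i)\<^sup>2)"
    by (simp add: norm_vec_def L2_set_def sum_nonneg)
  then have e: "exp (- ((norm x)\<^sup>2 / (4 * t))) = (\<Prod>i\<in>UNIV. exp (- ((x $ i)\<^sup>2 / (4 * t))))"
    by (simp add: exp_sum sum_divide_distrib sum_negf flip: sum_negf)
  have "(4 * pi * t) powr (- (real CARD('n) / 2)) = ((4 * pi * t) powr (- (1 / 2))) powr real CARD('n)"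
    by (subst powr_powr) simp
  also have "\<dots> = (1 / sqrt (4 * pi * t)) ^ CARD('n)"
    using assms by (simp add: powr_realpow powr_minus_divide powr_half_sqrt)
  finally have "heat_kernel t x = (\<Prod>i\<in>(UNIV :: 'n set). 1 / sqrt (4 * pi * t)) * (\<Prod>i\<in>UNIV. exp (- ((x $ i)\<^sup>2 / (4 * t))))"
    unfolding heat_kernel_def e by simp
  then show ?thesis
    using assms unfolding prod.distrib[symmetric] by (simp add: normal_density_def mult.assoc)
qed

lemma nn_integral_normal_density_conv:
  assumes "0 < t" "0 < s"
  shows "(\<integral>\<^sup>+v. ennreal (normal_density 0 (sqrt (2 * t)) (u - v) * normal_density 0 (sqrt (2 * s)) (v - w)) \<partial>lborel)
    = ennreal (normal_density 0 (sqrt (2 * (t + s))) (u - w))"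
proof -
  have "(\<integral>\<^sup>+v. ennreal (normal_density 0 (sqrt (2 * t)) (u - v) * normal_density 0 (sqrt (2 * s)) (v - w)) \<partial>lborel)
      = (\<integral>\<^sup>+v. ennreal (normal_density 0 (sqrt (2 * t)) ((u - w) - v) * normal_density 0 (sqrt (2 * s)) v) \<partial>lborel)"
    by (subst nn_integral_real_affine[of _ 1 w]) (auto simp: algebra_simps)
  also have "\<dots> = ennreal (normal_density 0 (sqrt ((sqrt (2 * t))\<^sup>2 + (sqrt (2 * s))\<^sup>2)) (u - w))"
    by (rule fun_cong[OF conv_normal_density_zero_mean]) (use assms in auto)
  finally show ?thesis using assms by (simp add: distrib_left)
qed

lemma nn_integral_heat_kernel_conv:
  fixes x z :: "real^'n"
  assumes t: "0 < t" and s: "0 < s"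
  shows "(\<integral>\<^sup>+y. ennreal (heat_kernel t (x - y) * heat_kernel s (y - z)) \<partial>lborel)
    = ennreal (heat_kernel (t + s) (x - z))"
proof -
  let ?N = "\<lambda>t. normal_density 0 (sqrt (2 * t))"
  have "ennreal (heat_kernel t (x - y) * heat_kernel s (y - z))
      = (\<Prod>i\<in>UNIV. ennreal (?N t (x $ i - y $ i) * ?N s (y $ i - z $ i)))" for y
    using t s by (simp add: heat_kernel_eq_prod prod_ennreal prod.distrib normal_density_nonneg)
  then have "(\<integral>\<^sup>+y. ennreal (heat_kernel t (x - y) * heat_kernel s (y - z)) \<partial>lborel)
      = (\<integral>\<^sup>+y. (\<Prod>i\<in>UNIV. ennreal (?N t (x $ i - y $ i) * ?N s (y $ i - z $ i))) \<partial>lborel)"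
    by simp
  also have "\<dots> = (\<Prod>i\<in>UNIV. \<integral>\<^sup>+v. ennreal (?N t (x $ i - v) * ?N s (v - z $ i)) \<partial>lborel)"
    by (rule nn_integral_lborel_vec) measurable
  also have "\<dots> = ennreal (heat_kernel (t + s) (x - z))"
    using t s by (simp add: nn_integral_normal_density_conv heat_kernel_eq_prod prod_ennreal normal_density_nonneg)
  finally show ?thesis .
qed

lemma has_bochner_integral_heat_kernel_conv:
  fixes x z :: "real^'n"
  assumes "0 < t" "0 < s"
  shows "has_bochner_integral lborel (\<lambda>y. heat_kernel t (x - y) * heat_kernel s (y - z))
    (heat_kernel (t + s) (x - z))"
  by (rule has_bochner_integral_nn_integral) (use nn_integral_heat_kernel_conv[OF assms] in auto)

definition heat_cov :: "(real^'n) \<times> real \<Rightarrow> (real^'n) \<times> real \<Rightarrow> real"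
  where "heat_cov p q = heat_kernel (snd p + snd q) (fst p - fst q)"

text \<open>By the semigroup property the covariance is the Gram matrix of the functions
  \<open>\<lambda>y. heat_kernel (snd p) (fst p - y)\<close> in \<open>L\<^sup>2\<close>.\<close>

lemma psd_kernel_heat_cov: "psd_kernel D0 (heat_cov :: (real^'n) \<times> real \<Rightarrow> _)"
  unfolding psd_kernel_def
proof (intro conjI ballI allI impI)
  fix p q :: "(real^'n) \<times> real"
  show "heat_cov p q = heat_cov q p"
    by (simp add: heat_cov_def heat_kernel_swap[of _ "fst p"] add.commute)
next
  fix n :: nat and c :: "nat \<Rightarrow> real" and p :: "nat \<Rightarrow> (real^'n) \<times> real"
  assume p: "\<forall>i<n. p i \<in> D0"
  define h where "h i y = heat_kernel (snd (p i)) (fst (p i) - y)" for i y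
  have "has_bochner_integral lborel (\<lambda>y. \<Sum>i<n. \<Sum>j<n. c i * c j * (h i y * h j y))
      (\<Sum>i<n. \<Sum>j<n. c i * c j * heat_cov (p i) (p j))"
  proof (intro has_bochner_integral_sum has_bochner_integral_mult_right)
    fix i j assume "i \<in> {..<n}" "j \<in> {..<n}"
    then have "0 < snd (p i)" "0 < snd (p j)" using p by (auto simp: D0_def mem_Times_iff)
    from has_bochner_integral_heat_kernel_conv[OF this, of "fst (p i)" "fst (p j)"]
    show "has_bochner_integral lborel (\<lambda>y. h i y * h j y) (heat_cov (p i) (p j))"
      by (simp add: h_def heat_cov_def heat_kernel_swap[of _ "fst (p j)"])
  qed
  then have "(\<Sum>i<n. \<Sum>j<n. c i * c j * heat_cov (p i) (p j))
      = (\<integral>y. (\<Sum>i<n. \<Sum>j<n. c i * c j * (h i y * h j y)) \<partial>lborel)"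
    by (simp add: has_bochner_integral_iff)
  also have "\<dots> = (\<integral>y. (\<Sum>i<n. c i * h i y)\<^sup>2 \<partial>lborel)"
    by (simp add: power2_eq_square sum_product algebra_simps)
  also have "\<dots> \<ge> 0" by simp
  finally show "0 \<le> (\<Sum>i<n. \<Sum>j<n. c i * c j * heat_cov (p i) (p j))" .
qed

text \<open>The weight has to be integrable, to dominate every heat kernel whatever its time, and to satisfy
  \<open>weight (x - y) \<le> weight y / weight x\<close>, so that translates of a kernel are still dominated. A Gaussian
  weight would fail the last two requirements; the exponential of a norm meets all three, and for the
  \<open>l\<^sup>1\<close>-norm the integral factorizes.\<close>

definition weight :: "real^'n \<Rightarrow> real"
  where "weight x = exp (- (\<Sum>i\<in>UNIV. \<bar>x $ i\<bar>))"

lemma weight_pos [simp]: "0 < weight x" and weight_nonneg [simp]: "0 \<le> weight x"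
  and weight_nonzero [simp]: "weight x \<noteq> 0"
  by (simp_all add: weight_def)

lemma continuous_on_weight [continuous_intros]: "continuous_on A weight"
  unfolding weight_def by (intro continuous_intros)

lemma measurable_weight [measurable]: "weight \<in> borel_measurable borel"
  by (intro borel_measurable_continuous_onI continuous_on_weight)

lemma weight_add_ge: "weight x * weight y \<le> weight (x + y)"
proof -
  have "(\<Sum>i\<in>UNIV. \<bar>(x + y) $ i\<bar>) \<le> (\<Sum>i\<in>UNIV. \<bar>x $ i\<bar>) + (\<Sum>i\<in>UNIV. \<bar>y $ i\<bar>)"
    unfolding sum.distrib[symmetric] by (intro sum_mono) (simp add: abs_triangle_ineq)
  then show ?thesis unfolding weight_def exp_add[symmetric] by simp
qed

lemma weight_minus [simp]: "weight (- x) = weight x"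
  by (simp add: weight_def)

lemma nn_integral_exp_abs_finite: "(\<integral>\<^sup>+u. ennreal (exp (- \<bar>u\<bar>)) \<partial>(lborel :: real measure)) < \<infinity>"
proof -
  have le: "exp (- \<bar>u\<bar>) \<le> 2 * inverse (1 + u\<^sup>2)" for u :: real
  proof -
    have "1 + \<bar>u\<bar> + \<bar>u\<bar>\<^sup>2 / 2 \<le> exp \<bar>u\<bar>" by (rule exp_lower_Taylor_quadratic) simp
    then have "(1 + u\<^sup>2) / 2 \<le> exp \<bar>u\<bar>"
      unfolding power2_abs add_divide_distrib using abs_ge_zero[of u] by linarith
    then have "inverse (exp \<bar>u\<bar>) \<le> inverse ((1 + u\<^sup>2) / 2)"
      by (rule le_imp_inverse_le) (simp add: add_pos_nonneg)
    also have "inverse ((1 + u\<^sup>2) / 2) = 2 * inverse (1 + u\<^sup>2)"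
      unfolding inverse_divide by (simp only: divide_inverse)
    finally show ?thesis unfolding exp_minus .
  qed
  have "integrable lborel (\<lambda>u::real. inverse (1 + u\<^sup>2))"
    using integrable_inverse_1_plus_square by (simp add: set_integrable_def)
  then have "integrable lborel (\<lambda>u::real. 2 * inverse (1 + u\<^sup>2))" by simp
  then have "integrable lborel (\<lambda>u::real. exp (- \<bar>u\<bar>))"
    by (rule Bochner_Integration.integrable_bound) (use order_trans[OF le abs_ge_self] in auto)
  then show ?thesis by (simp add: integrable_iff_bounded)
qed

lemma integrable_weight: "integrable lborel (weight :: real^'n \<Rightarrow> real)"
proof -
  have "(\<integral>\<^sup>+x. ennreal (weight x) \<partial>(lborel :: (real^'n) measure))
      = (\<integral>\<^sup>+x. (\<Prod>i\<in>UNIV. ennreal (exp (- \<bar>x $ i\<bar>))) \<partial>(lborel :: (real^'n) measure))"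
    by (simp add: weight_def exp_sum sum_negf[symmetric] prod_ennreal)
  also have "\<dots> = (\<Prod>i\<in>(UNIV :: 'n set). \<integral>\<^sup>+u. ennreal (exp (- \<bar>u\<bar>)) \<partial>lborel)"
    by (rule nn_integral_lborel_vec) measurable
  also have "\<dots> < \<infinity>"
    using nn_integral_exp_abs_finite power_less_top_ennreal by (auto simp: power_less_top_ennreal)
  finally show ?thesis by (auto intro!: integrableI_nonneg)
qed

section \<open>The Borel sets of the space of \<open>C\<^sup>2\<^sup>,\<^sup>1\<close> functions\<close>

lemma open_D0: "open D0"
  unfolding D0_def by (intro open_Times) auto

text \<open>The finitely many differential operators that define the topology, collected in one set so that they
  can be treated uniformly.\<close>

definition C21_jet :: "(((real^'n) \<times> real \<Rightarrow> real) \<Rightarrow> (real^'n) \<times> real \<Rightarrow> real) set"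
  where "C21_jet = {\<lambda>f. f, partial e_time} \<union> range (\<lambda>i. partial (e_space i)) \<union>
    range (\<lambda>(i, j) f. partial (e_space j) (partial (e_space i) f))"

lemma finite_C21_jet: "finite C21_jet"
  by (simp add: C21_jet_def)

lemma C21_nbhd_eq_jet: "C21_nbhd f K \<epsilon> = {g \<in> C21. \<forall>p\<in>K. \<forall>J\<in>C21_jet. \<bar>J g p - J f p\<bar> < \<epsilon>}"
  unfolding C21_nbhd_def C21_jet_def by (auto simp: ball_Un)

lemma continuous_on_C21_jet:
  assumes "f \<in> C21" "J \<in> C21_jet"
  shows "continuous_on D0 (J f)"
  using assms unfolding C21_def C21_jet_def by auto

text \<open>A partial derivative is the limit of difference quotients along one fixed sequence of increments, chosen
  small enough to stay in \<open>S\<close>.\<close>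

lemma measurable_partial:
  assumes S: "open S" "p \<in> S" and meas: "\<And>q. q \<in> S \<Longrightarrow> (\<lambda>\<omega>. F \<omega> q) \<in> borel_measurable M"
    and part: "\<And>\<omega>. \<omega> \<in> space M \<Longrightarrow> has_partial v (F \<omega>) p"
  shows "(\<lambda>\<omega>. partial v (F \<omega>) p) \<in> borel_measurable M"
proof -
  obtain e where e: "0 < e" "ball p e \<subseteq> S"
    using S by (meson openE)
  define \<delta> where "\<delta> n = e / (norm v + 1) / real (Suc n)" for n
  have nv: "0 < norm v + 1" by (simp add: add_nonneg_pos)
  have pos: "0 < \<delta> n" for n
    unfolding \<delta>_def using e nv by (intro divide_pos_pos) auto
  have in_S: "p + \<delta> n *\<^sub>R v \<in> S" for n
  proof -
    have "\<delta> n \<le> e / (norm v + 1)"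
      unfolding \<delta>_def using e nv by (intro divide_left_mono[where b = 1, simplified]) (auto simp: mult_le_cancel_left1 intro: divide_nonneg_nonneg)
    then have "\<delta> n * norm v \<le> e / (norm v + 1) * norm v" by (rule mult_right_mono) simp
    also have "\<dots> < e" using e nv by (simp add: field_simps)
    finally have "p + \<delta> n *\<^sub>R v \<in> ball p e" using pos[of n] by (simp add: dist_norm)
    then show ?thesis using e by blast
  qed
  have "(\<lambda>n. e / (norm v + 1) * (1 / real (Suc n))) \<longlonglongrightarrow> e / (norm v + 1) * 0"
    by (intro tendsto_mult tendsto_const LIMSEQ_Suc[OF lim_1_over_n])
  then have "\<delta> \<longlonglongrightarrow> 0" unfolding \<delta>_def by simp
  then have \<delta>: "filterlim \<delta> (at 0) sequentially"
    using pos by (intro filterlim_atI) (auto simp: less_imp_neq[symmetric] intro!: always_eventually)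
  show ?thesis
  proof (rule borel_measurable_LIMSEQ_real)
    fix \<omega> assume "\<omega> \<in> space M"
    then have "((\<lambda>h::real. F \<omega> (p + h *\<^sub>R v)) has_field_derivative partial v (F \<omega>) p) (at 0)"
      using part unfolding has_partial_def partial_def DERIV_deriv_iff_field_differentiable by blast
    then have "((\<lambda>h. (F \<omega> (p + h *\<^sub>R v) - F \<omega> p) / h) \<longlongrightarrow> partial v (F \<omega>) p) (at 0)"
      unfolding DERIV_def by simp
    from filterlim_compose[OF this \<delta>]
    show "(\<lambda>n. (F \<omega> (p + \<delta> n *\<^sub>R v) - F \<omega> p) / \<delta> n) \<longlonglongrightarrow> partial v (F \<omega>) p" .
  next
    show "(\<lambda>\<omega>. (F \<omega> (p + \<delta> n *\<^sub>R v) - F \<omega> p) / \<delta> n) \<in> borel_measurable M" for n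
      using meas[OF in_S] meas[OF S(2)] by measurable
  qed
qed

lemma measurable_C21_jet:
  assumes C21: "\<And>\<omega>. \<omega> \<in> space M \<Longrightarrow> \<phi> \<omega> \<in> C21"
    and meas: "\<And>q. q \<in> D0 \<Longrightarrow> (\<lambda>\<omega>. \<phi> \<omega> q) \<in> borel_measurable M"
    and J: "J \<in> C21_jet" and p: "p \<in> D0"
  shows "(\<lambda>\<omega>. J (\<phi> \<omega>) p) \<in> borel_measurable M"
proof -
  have 1: "(\<lambda>\<omega>. partial (e_space i) (\<phi> \<omega>) q) \<in> borel_measurable M" if "q \<in> D0" for i q
    by (rule measurable_partial[OF open_D0 that meas]) (use C21 that in \<open>auto simp: C21_def\<close>)
  have 2: "(\<lambda>\<omega>. partial (e_space j) (partial (e_space i) (\<phi> \<omega>)) p) \<in> borel_measurable M" for i j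
    by (rule measurable_partial[OF open_D0 p 1]) (use C21 p in \<open>auto simp: C21_def\<close>)
  have 3: "(\<lambda>\<omega>. partial e_time (\<phi> \<omega>) p) \<in> borel_measurable M"
    by (rule measurable_partial[OF open_D0 p meas]) (use C21 p in \<open>auto simp: C21_def\<close>)
  show ?thesis using J 1[OF p] 2 3 meas[OF p] by (auto simp: C21_jet_def)
qed

text \<open>The sets \<open>jet_box J b l u\<close> with \<open>b\<close> in a countable basis and rational \<open>l\<close>, \<open>u\<close> take the place
  of the uncountable subbase of the topology. With closed value intervals and open \<open>b\<close> the condition can be
  tested on a dense subset of \<open>b\<close>, which makes the boxes measurable.\<close>

definition jet_box ::
    "(((real^'n) \<times> real \<Rightarrow> real) \<Rightarrow> (real^'n) \<times> real \<Rightarrow> real) \<Rightarrow> ((real^'n) \<times> real) set \<Rightarrow>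
     real \<Rightarrow> real \<Rightarrow> ((real^'n) \<times> real \<Rightarrow> real) set"
  where "jet_box J b l u = {g \<in> C21. \<forall>q\<in>b. l \<le> J g q \<and> J g q \<le> u}"

lemma continuous_on_nbhd_rational_bounds:
  fixes h h0 :: "'a::metric_space \<Rightarrow> real"
  assumes S: "open S" "p \<in> S" and h: "continuous_on S h" and h0: "continuous_on S h0"
    and less: "\<bar>h p - h0 p\<bar> < \<epsilon>"
  obtains U l u where "open U" "p \<in> U" "U \<subseteq> S" "l \<in> \<rat>" "u \<in> \<rat>"
    "\<And>q. q \<in> U \<Longrightarrow> l \<le> h q \<and> h q \<le> u" "\<And>q v. q \<in> U \<Longrightarrow> l \<le> v \<Longrightarrow> v \<le> u \<Longrightarrow> \<bar>v - h0 q\<bar> < \<epsilon>"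
proof -
  define \<eta> where "\<eta> = (\<epsilon> - \<bar>h p - h0 p\<bar>) / 3"
  have \<eta>: "0 < \<eta>" using less by (simp add: \<eta>_def)
  obtain l where l: "l \<in> \<rat>" "h p - \<eta> < l" "l < h p"
    using Rats_dense_in_real[of "h p - \<eta>" "h p"] \<eta> by auto
  obtain u where u: "u \<in> \<rat>" "h p < u" "u < h p + \<eta>"
    using Rats_dense_in_real[of "h p" "h p + \<eta>"] \<eta> by auto
  define U where "U = (S \<inter> h -` {l<..<u}) \<inter> (S \<inter> h0 -` {h0 p - \<eta><..<h0 p + \<eta>})"
  show ?thesis
  proof (rule that[of U l u])
    show "open U" unfolding U_def
      using S(1) h h0 by (intro open_Int continuous_open_preimage) auto
    show "\<bar>v - h0 q\<bar> < \<epsilon>" if "q \<in> U" "l \<le> v" "v \<le> u" for q v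
    proof -
      have "\<bar>h0 q - h0 p\<bar> < \<eta>" using that by (auto simp: U_def abs_less_iff)
      moreover have "\<bar>v - h p\<bar> < \<eta>" using that l u by (auto simp: abs_less_iff)
      moreover have "3 * \<eta> = \<epsilon> - \<bar>h p - h0 p\<bar>" by (simp add: \<eta>_def)
      ultimately show ?thesis using \<eta> by linarith
    qed
  qed (use S l u \<eta> in \<open>auto simp: U_def\<close>)
qed

text \<open>Around each point of \<open>K\<close> the values of a jet of \<open>f\<close> lie between rational bounds that force the distance
  to \<open>f0\<close> to be below \<open>\<epsilon>\<close>; compactness of \<open>K\<close> leaves finitely many such boxes for each of the finitely many
  jets.\<close>

lemma C21_nbhd_contains_jet_boxes:
  fixes f0 :: "(real^'n) \<times> real \<Rightarrow> real"
  assumes B: "topological_basis B" and f: "f \<in> C21_nbhd f0 K \<epsilon>" and f0: "f0 \<in> C21"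
    and K: "compact K" "K \<subseteq> D0"
  obtains T where "finite T" "T \<subseteq> {jet_box J b l u |J b l u. J \<in> C21_jet \<and> b \<in> B \<and> b \<subseteq> D0 \<and> l \<in> \<rat> \<and> u \<in> \<rat>}"
    "f \<in> C21 \<inter> \<Inter>T" "C21 \<inter> \<Inter>T \<subseteq> C21_nbhd f0 K \<epsilon>"
proof -
  have fC: "f \<in> C21" using f by (simp add: C21_nbhd_def)
  let ?W = "{jet_box J b l u |J b l u. J \<in> C21_jet \<and> b \<in> B \<and> b \<subseteq> D0 \<and> l \<in> \<rat> \<and> u \<in> \<rat>}"
  define Q where "Q J T \<longleftrightarrow> finite T \<and> T \<subseteq> ?W \<and> f \<in> C21 \<inter> \<Inter>T \<and>
      (\<forall>g \<in> C21 \<inter> \<Inter>T. \<forall>p\<in>K. \<bar>J g p - J f0 p\<bar> < \<epsilon>)" for J T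
  have "\<exists>T. Q J T" if J: "J \<in> C21_jet" for J
  proof -
    have "\<exists>b l u. p \<in> b \<and> b \<in> B \<and> b \<subseteq> D0 \<and> l \<in> \<rat> \<and> u \<in> \<rat> \<and> (\<forall>q\<in>b. l \<le> J f q \<and> J f q \<le> u) \<and>
        (\<forall>q\<in>b. \<forall>v. l \<le> v \<longrightarrow> v \<le> u \<longrightarrow> \<bar>v - J f0 q\<bar> < \<epsilon>)" if p: "p \<in> K" for p
    proof -
      have "\<bar>J f p - J f0 p\<bar> < \<epsilon>" using f p J by (auto simp: C21_nbhd_eq_jet)
      then obtain U l u where U: "open U" "p \<in> U" "U \<subseteq> D0" "l \<in> \<rat>" "u \<in> \<rat>"
        "\<And>q. q \<in> U \<Longrightarrow> l \<le> J f q \<and> J f q \<le> u"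
        "\<And>q v. q \<in> U \<Longrightarrow> l \<le> v \<Longrightarrow> v \<le> u \<Longrightarrow> \<bar>v - J f0 q\<bar> < \<epsilon>"
        using continuous_on_nbhd_rational_bounds[OF open_D0 _ continuous_on_C21_jet[OF fC J]
            continuous_on_C21_jet[OF f0 J], of p \<epsilon>] p K by blast
      obtain b where "b \<in> B" "p \<in> b" "b \<subseteq> U" using topological_basisE[OF B U(1,2)] by blast
      moreover have "b \<subseteq> D0" "\<forall>q\<in>b. l \<le> J f q \<and> J f q \<le> u"
        "\<forall>q\<in>b. \<forall>v. l \<le> v \<longrightarrow> v \<le> u \<longrightarrow> \<bar>v - J f0 q\<bar> < \<epsilon>"
        using \<open>b \<subseteq> U\<close> U by blast+
      ultimately show ?thesis using U(4,5) by (intro exI[of _ b] exI[of _ l] exI[of _ u] conjI)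
    qed
    then obtain b l u where blu: "\<And>p. p \<in> K \<Longrightarrow> p \<in> b p \<and> b p \<in> B \<and> b p \<subseteq> D0 \<and> l p \<in> \<rat> \<and> u p \<in> \<rat> \<and>
        (\<forall>q\<in>b p. l p \<le> J f q \<and> J f q \<le> u p) \<and>
        (\<forall>q\<in>b p. \<forall>v. l p \<le> v \<longrightarrow> v \<le> u p \<longrightarrow> \<bar>v - J f0 q\<bar> < \<epsilon>)"
      by metis
    have "\<And>p. p \<in> K \<Longrightarrow> open (b p)" using blu topological_basis_open[OF B] by blast
    moreover have "K \<subseteq> (\<Union>p\<in>K. b p)" using blu by blast
    ultimately obtain K' where K': "K' \<subseteq> K" "finite K'" "K \<subseteq> (\<Union>p\<in>K'. b p)"
      by (rule compactE_image[OF K(1)])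
    let ?T = "(\<lambda>p. jet_box J (b p) (l p) (u p)) ` K'"
    have "?T \<subseteq> ?W" using K'(1) blu J by blast
    moreover have "f \<in> C21 \<inter> \<Inter>?T" using K'(1) blu fC unfolding jet_box_def by blast
    moreover have "\<bar>J g p - J f0 p\<bar> < \<epsilon>" if g: "g \<in> C21 \<inter> \<Inter>?T" and p: "p \<in> K" for g p
    proof -
      obtain p' where p': "p' \<in> K'" "p \<in> b p'" using K'(3) p by blast
      have "l p' \<le> J g p \<and> J g p \<le> u p'" using g p' unfolding jet_box_def by blast
      then show ?thesis using blu[of p'] p' K'(1) by blast
    qed
    ultimately have "Q J ?T" unfolding Q_def using finite_imageI[OF K'(2)] by (intro conjI ballI)
    then show ?thesis by blast
  qed
  then obtain T where QT: "\<And>J. J \<in> C21_jet \<Longrightarrow> Q J (T J)"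
    by metis
  then have T: "finite (T J)" "T J \<subseteq> ?W" "f \<in> \<Inter>(T J)"
    "g \<in> C21 \<Longrightarrow> g \<in> \<Inter>(T J) \<Longrightarrow> p \<in> K \<Longrightarrow> \<bar>J g p - J f0 p\<bar> < \<epsilon>" if "J \<in> C21_jet" for J g p
    using that unfolding Q_def by blast+
  show ?thesis
  proof (rule that[of "\<Union>(T ` C21_jet)"])
    show "finite (\<Union>(T ` C21_jet))" using T finite_C21_jet by blast
    show "\<Union>(T ` C21_jet) \<subseteq> ?W" using T by blast
    show "f \<in> C21 \<inter> \<Inter>(\<Union>(T ` C21_jet))" using T(3) fC by blast
    show "C21 \<inter> \<Inter>(\<Union>(T ` C21_jet)) \<subseteq> C21_nbhd f0 K \<epsilon>"
      unfolding C21_nbhd_eq_jet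
    proof (intro subsetI CollectI conjI ballI)
      fix g p and J :: "((real^'n) \<times> real \<Rightarrow> real) \<Rightarrow> (real^'n) \<times> real \<Rightarrow> real"
      assume g: "g \<in> C21 \<inter> \<Inter>(\<Union>(T ` C21_jet))" and p: "p \<in> K" and J: "J \<in> C21_jet"
      then show "\<bar>J g p - J f0 p\<bar> < \<epsilon>" by (intro T(4)) auto
    qed simp
  qed
qed

lemma measurable_jet_box:
  fixes \<phi> :: "'w \<Rightarrow> (real^'n) \<times> real \<Rightarrow> real" and b :: "((real^'n) \<times> real) set"
  assumes C21: "\<And>\<omega>. \<omega> \<in> space M \<Longrightarrow> \<phi> \<omega> \<in> C21"
    and meas: "\<And>q. q \<in> D0 \<Longrightarrow> (\<lambda>\<omega>. \<phi> \<omega> q) \<in> borel_measurable M"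
    and J: "J \<in> C21_jet" and b: "open b" "b \<subseteq> D0"
  shows "\<phi> -` jet_box J b l u \<inter> space M \<in> sets M"
proof -
  obtain D :: "((real^'n) \<times> real) set" where D: "countable D" "\<And>X. open X \<Longrightarrow> X \<noteq> {} \<Longrightarrow> \<exists>d\<in>D. d \<in> X"
    using countable_dense_setE by blast
  have iff: "(\<forall>q\<in>b. l \<le> J g q \<and> J g q \<le> u) \<longleftrightarrow> (\<forall>q\<in>b \<inter> D. l \<le> J g q \<and> J g q \<le> u)" if g: "g \<in> C21" for g
  proof (intro iffI ballI)
    fix q assume *: "\<forall>q\<in>b \<inter> D. l \<le> J g q \<and> J g q \<le> u" and "q \<in> b"
    show "l \<le> J g q \<and> J g q \<le> u"
    proof (rule ccontr)
      let ?X = "b \<inter> J g -` (- {l..u})"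
      assume "\<not> (l \<le> J g q \<and> J g q \<le> u)"
      then have "?X \<noteq> {}" using \<open>q \<in> b\<close> by auto
      moreover have "open ?X"
        using continuous_on_subset[OF continuous_on_C21_jet[OF g J] b(2)] b(1)
        by (intro continuous_open_preimage) auto
      ultimately obtain d where "d \<in> D" "d \<in> ?X" using D(2) by blast
      then show False using * by auto
    qed
  qed blast
  have "\<phi> -` jet_box J b l u \<inter> space M = {\<omega> \<in> space M. \<forall>q\<in>b \<inter> D. l \<le> J (\<phi> \<omega>) q \<and> J (\<phi> \<omega>) q \<le> u}"
    unfolding jet_box_def using C21 iff by auto
  also have "\<dots> \<in> sets M"
  proof (rule sets.sets_Collect_countable_All')
    show "countable (b \<inter> D)" using D(1) by blast
    show "{\<omega> \<in> space M. l \<le> J (\<phi> \<omega>) q \<and> J (\<phi> \<omega>) q \<le> u} \<in> sets M" if "q \<in> b \<inter> D" for q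
    proof -
      have [measurable]: "(\<lambda>\<omega>. J (\<phi> \<omega>) q) \<in> borel_measurable M"
        using measurable_C21_jet[OF C21 meas J, of q] that b(2) by blast
      show ?thesis by measurable
    qed
  qed
  finally show ?thesis .
qed

text \<open>Every open set is a union of finite intersections of jet boxes, and there are only countably
  many of these: measurability of the evaluations suffices.\<close>

theorem measurable_borel_C21:
  fixes \<phi> :: "'w \<Rightarrow> (real^'n) \<times> real \<Rightarrow> real"
  assumes C21: "\<And>\<omega>. \<omega> \<in> space M \<Longrightarrow> \<phi> \<omega> \<in> C21"
    and meas: "\<And>q. q \<in> D0 \<Longrightarrow> (\<lambda>\<omega>. \<phi> \<omega> q) \<in> borel_measurable M"
  shows "\<phi> \<in> measurable M (borel_of_topology C21_topology)"
proof -
  obtain B :: "((real^'n) \<times> real) set set" where B: "countable B" "topological_basis B"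
    using ex_countable_basis by blast
  define W where "W = {jet_box J b l u |J b l u. J \<in> C21_jet \<and> b \<in> B \<and> b \<subseteq> D0 \<and> l \<in> \<rat> \<and> u \<in> \<rat>}"
  define F where "F = (\<lambda>T. C21 \<inter> \<Inter>T) ` {T. finite T \<and> T \<subseteq> W}"
  have "W \<subseteq> (\<lambda>(J, b, l, u). jet_box J b l u) ` (C21_jet \<times> B \<times> \<rat> \<times> \<rat>)"
    unfolding W_def by force
  moreover have "countable (C21_jet \<times> B \<times> (\<rat> :: real set) \<times> (\<rat> :: real set))"
    by (intro countable_SIGMA countable_finite[OF finite_C21_jet] B(1) countable_rat)
  ultimately have "countable W" by (rule countable_subset[OF _ countable_image])
  then have "countable F" unfolding F_def
    by (intro countable_image countable_Collect_finite_subset)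
  have FE: "\<exists>T. T \<subseteq> W \<and> finite T \<and> A = C21 \<inter> \<Inter>T" if "A \<in> F" for A
    using that[unfolded F_def] by (elim imageE CollectE conjE) (intro exI conjI)
  have FI: "C21 \<inter> \<Inter>T \<in> F" if "T \<subseteq> W" "finite T" for T
    unfolding F_def using that by (intro imageI CollectI conjI)
  have W_meas: "\<phi> -` w \<inter> space M \<in> sets M" if w: "w \<in> W" for w
  proof -
    obtain J b l u where "w = jet_box J b l u" "J \<in> C21_jet" "b \<in> B" "b \<subseteq> D0"
      using w unfolding W_def by blast
    then show ?thesis
      using measurable_jet_box[OF C21 meas _ topological_basis_open[OF B(2)]] by blast
  qed
  have F_meas: "\<phi> -` A \<inter> space M \<in> sets M" if "A \<in> F" for A
  proof -
    obtain T where T: "T \<subseteq> W" "finite T" "A = C21 \<inter> \<Inter>T" using FE[OF \<open>A \<in> F\<close>] by metis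
    have "\<phi> -` A \<inter> space M = {\<omega> \<in> space M. \<forall>w\<in>T. \<phi> \<omega> \<in> w}"
      unfolding T(3) using C21 by blast
    also have "\<dots> \<in> sets M"
    proof (rule sets.sets_Collect_finite_All[OF _ T(2)])
      fix w assume "w \<in> T"
      then have "\<phi> -` w \<inter> space M \<in> sets M" using W_meas T(1) by blast
      also have "\<phi> -` w \<inter> space M = {\<omega> \<in> space M. \<phi> \<omega> \<in> w}" by blast
      finally show "{\<omega> \<in> space M. \<phi> \<omega> \<in> w} \<in> sets M" .
    qed
    finally show ?thesis .
  qed
  have F_Int: "A \<inter> A' \<in> F" if "A \<in> F" "A' \<in> F" for A A'
  proof -
    obtain T where T: "T \<subseteq> W" "finite T" "A = C21 \<inter> \<Inter>T" using FE[OF \<open>A \<in> F\<close>] by metis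
    obtain T' where T': "T' \<subseteq> W" "finite T'" "A' = C21 \<inter> \<Inter>T'" using FE[OF \<open>A' \<in> F\<close>] by metis
    have "A \<inter> A' = C21 \<inter> \<Inter>(T \<union> T')" unfolding T(3) T'(3) by blast
    then show ?thesis using FI[of "T \<union> T'"] T T' by simp
  qed
  have base: "\<exists>A\<in>F. f \<in> A \<and> A \<subseteq> U" if "openin C21_topology U" "f \<in> U" for U f
    using that(1)[unfolded C21_topology_def openin_topology_generated_by_iff] that(2)
  proof (induction arbitrary: f rule: generate_topology_on.induct)
    case (Int a b)
    then obtain A A' where "A \<in> F" "f \<in> A" "A \<subseteq> a" "A' \<in> F" "f \<in> A'" "A' \<subseteq> b" by blast
    then show ?case using F_Int[of A A'] by (intro bexI[of _ "A \<inter> A'"]) auto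
  next
    case (UN K)
    from \<open>f \<in> \<Union>K\<close> obtain k where k: "k \<in> K" "f \<in> k" by (rule UnionE)
    from UN.IH[OF k] obtain A where "A \<in> F" "f \<in> A" "A \<subseteq> k" by (elim bexE conjE)
    then show ?case using subset_trans[OF _ Union_upper[OF k(1)]] by (intro bexI[of _ A] conjI)
  next
    case (Basis s)
    then obtain f0 K \<epsilon> where s: "s = C21_nbhd f0 K \<epsilon>" "f0 \<in> C21" "compact K" "K \<subseteq> D0" by blast
    have "f \<in> C21_nbhd f0 K \<epsilon>" using Basis(2) s(1) by simp
    from C21_nbhd_contains_jet_boxes[OF B(2) this s(2-4), folded W_def]
    obtain T where "finite T" "T \<subseteq> W" "f \<in> C21 \<inter> \<Inter>T" "C21 \<inter> \<Inter>T \<subseteq> s" unfolding s(1) .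
    then show ?case using FI[of T] by (intro bexI[of _ "C21 \<inter> \<Inter>T"] conjI)
  qed simp
  show ?thesis unfolding borel_of_topology_def
  proof (rule measurable_measure_of)
    show "{U. openin C21_topology U} \<subseteq> Pow (topspace C21_topology)"
      using openin_subset by blast
    show "\<phi> \<in> space M \<rightarrow> topspace C21_topology" using C21 by (simp add: topspace_C21_topology)
    fix U :: "((real^'n) \<times> real \<Rightarrow> real) set" assume "U \<in> {U. openin C21_topology U}"
    then have U: "openin C21_topology U" by simp
    have "\<phi> -` U \<inter> space M = (\<Union>A\<in>{A\<in>F. A \<subseteq> U}. \<phi> -` A \<inter> space M)"
      using base[OF U] by blast
    also have "\<dots> \<in> sets M"
      using \<open>countable F\<close> F_meas by (intro sets.countable_UN') auto
    finally show "\<phi> -` U \<inter> space M \<in> sets M" .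
  qed
qed

section \<open>Kernels generated by differentiating the heat kernel\<close>

text \<open>Unlike \<^const>\<open>partial\<close>, this relation names the derivative, which lets the derivative be tracked as a
  member of a class of kernels.\<close>

definition has_deriv_along :: "(real^'n) \<times> real \<Rightarrow> ((real^'n) \<times> real \<Rightarrow> real) \<Rightarrow> ((real^'n) \<times> real \<Rightarrow> real) \<Rightarrow> bool"
  where "has_deriv_along v P Q \<longleftrightarrow>
    (\<forall>p\<in>D0. ((\<lambda>h. P (p + h *\<^sub>R v)) has_real_derivative Q p) (at 0))"

lemma has_deriv_alongD:
  assumes "has_deriv_along v P Q" "p \<in> D0"
  shows "((\<lambda>h. P (p + h *\<^sub>R v)) has_real_derivative Q p) (at 0)"
  using assms by (simp add: has_deriv_along_def)

text \<open>The functions \<open>heat_kernel t x\<close> times a polynomial in \<open>x\<close> and \<open>1 / t\<close>. This class contains the heat kernel,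
  is closed under all partial derivatives, and its members decay faster than any power of \<open>weight\<close>,
  locally uniformly in \<open>t > 0\<close>. So one differentiation under the integral sign can be iterated forever.\<close>

inductive heat_poly :: "((real^'n) \<times> real \<Rightarrow> real) \<Rightarrow> bool"
  where
    kernel: "heat_poly (\<lambda>p. heat_kernel (snd p) (fst p))"
  | coord: "heat_poly P \<Longrightarrow> heat_poly (\<lambda>p. fst p $ i * P p)"
  | over_time: "heat_poly P \<Longrightarrow> heat_poly (\<lambda>p. P p / snd p)"
  | scale: "heat_poly P \<Longrightarrow> heat_poly (\<lambda>p. c * P p)"
  | add: "heat_poly P \<Longrightarrow> heat_poly Q \<Longrightarrow> heat_poly (\<lambda>p. P p + Q p)"

lemma heat_poly_sum:
  assumes "finite I" "\<And>i. i \<in> I \<Longrightarrow> heat_poly (P i)"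
  shows "heat_poly (\<lambda>p. \<Sum>i\<in>I. P i p)"
  using assms
proof (induction I rule: finite_induct)
  case empty
  show ?case using heat_poly.scale[OF heat_poly.kernel, of 0] by simp
qed (simp add: heat_poly.add)

lemma norm_vec_power2: "(norm x)\<^sup>2 = (\<Sum>i\<in>UNIV. (x $ i)\<^sup>2)"
  for x :: "real^'n"
  by (simp add: norm_vec_def L2_set_def sum_nonneg)

lemma has_deriv_along_heat_kernel:
  fixes a :: "real^'n"
  shows "has_deriv_along (a, b) (\<lambda>p. heat_kernel (snd p) (fst p))
    (\<lambda>p. (b * ((norm (fst p))\<^sup>2 / (4 * (snd p)\<^sup>2) - CARD('n) / (2 * snd p)) - (fst p \<bullet> a) / (2 * snd p))
      * heat_kernel (snd p) (fst p))"
  unfolding has_deriv_along_def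
proof
  fix p :: "(real^'n) \<times> real" assume "p \<in> D0"
  then obtain x t where p: "p = (x, t)" and t: "0 < t" by (cases p) (auto simp: D0_def)
  have "(norm (x + h *\<^sub>R a))\<^sup>2 = (norm x)\<^sup>2 + 2 * h * (x \<bullet> a) + h\<^sup>2 * (norm a)\<^sup>2" for h
    unfolding power2_norm_eq_inner
    by (simp add: inner_add_left inner_add_right inner_commute power2_eq_square algebra_simps)
  then have eq: "heat_kernel (t + h * b) (x + h *\<^sub>R a) = (4 * pi * (t + h * b)) powr (- (real CARD('n) / 2)) *
      exp (- (((norm x)\<^sup>2 + 2 * h * (x \<bullet> a) + h\<^sup>2 * (norm a)\<^sup>2) / (4 * (t + h * b))))" for h
    by (simp add: heat_kernel_def)
  define r where "r = - (real CARD('n) / 2)"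
  have "(4 * pi * t) powr (r - 1) = (4 * pi * t) powr r / (4 * pi * t)"
    using t by (simp add: powr_diff)
  then have "((\<lambda>h. (4 * pi * (t + h * b)) powr r * exp (- ((m + 2 * h * k + h\<^sup>2 * l) / (4 * (t + h * b)))))
      has_real_derivative (b * (m / (4 * t\<^sup>2) - (- 2 * r) / (2 * t)) - k / (2 * t)) *
        ((4 * pi * t) powr r * exp (- (m / (4 * t))))) (at 0)" for m k l :: real
    using t by (auto intro!: derivative_eq_intros simp: field_simps power2_eq_square)
  from this[of "(norm x)\<^sup>2" "x \<bullet> a" "(norm a)\<^sup>2"]
  have "((\<lambda>h. heat_kernel (t + h * b) (x + h *\<^sub>R a)) has_real_derivative
      (b * ((norm x)\<^sup>2 / (4 * t\<^sup>2) - CARD('n) / (2 * t)) - (x \<bullet> a) / (2 * t)) * heat_kernel t x) (at 0)"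
    unfolding eq by (simp add: heat_kernel_def r_def)
  then show "((\<lambda>h. heat_kernel (snd (p + h *\<^sub>R (a, b))) (fst (p + h *\<^sub>R (a, b)))) has_real_derivative
      (b * ((norm (fst p))\<^sup>2 / (4 * (snd p)\<^sup>2) - CARD('n) / (2 * snd p)) - (fst p \<bullet> a) / (2 * snd p))
      * heat_kernel (snd p) (fst p)) (at 0)"
    by (simp add: p)
qed

lemma heat_poly_deriv_heat_kernel:
  fixes a :: "real^'n"
  shows "heat_poly (\<lambda>p. (b * ((norm (fst p))\<^sup>2 / (4 * (snd p)\<^sup>2) - CARD('n) / (2 * snd p)) - (fst p \<bullet> a) / (2 * snd p))
      * heat_kernel (snd p) (fst p))"
proof -
  let ?K = "\<lambda>p :: (real^'n) \<times> real. heat_kernel (snd p) (fst p)"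
  have "heat_poly (\<lambda>p. b / 4 * ((\<Sum>i\<in>UNIV. fst p $ i * (fst p $ i * ?K p)) / snd p / snd p) +
      (- b * CARD('n) / 2 * (?K p / snd p) + - (1 / 2) * ((\<Sum>i\<in>UNIV. a $ i * (fst p $ i * ?K p)) / snd p)))"
    by (intro heat_poly.intros heat_poly_sum finite)
  also have "(\<lambda>p. b / 4 * ((\<Sum>i\<in>UNIV. fst p $ i * (fst p $ i * ?K p)) / snd p / snd p) +
      (- b * CARD('n) / 2 * (?K p / snd p) + - (1 / 2) * ((\<Sum>i\<in>UNIV. a $ i * (fst p $ i * ?K p)) / snd p)))
    = (\<lambda>p. (b * ((norm (fst p))\<^sup>2 / (4 * (snd p)\<^sup>2) - CARD('n) / (2 * snd p)) - (fst p \<bullet> a) / (2 * snd p))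
      * ?K p)"
  proof
    fix p :: "(real^'n) \<times> real"
    have 1: "(\<Sum>i\<in>UNIV. fst p $ i * (fst p $ i * ?K p)) = (norm (fst p))\<^sup>2 * ?K p"
      unfolding norm_vec_power2 sum_distrib_right by (simp add: power2_eq_square mult.assoc)
    have 2: "(\<Sum>i\<in>UNIV. a $ i * (fst p $ i * ?K p)) = (fst p \<bullet> a) * ?K p"
      unfolding inner_vec_def sum_distrib_right by (intro sum.cong refl) (simp add: mult_ac)
    show "b / 4 * ((\<Sum>i\<in>UNIV. fst p $ i * (fst p $ i * ?K p)) / snd p / snd p) +
        (- b * CARD('n) / 2 * (?K p / snd p) + - (1 / 2) * ((\<Sum>i\<in>UNIV. a $ i * (fst p $ i * ?K p)) / snd p))
      = (b * ((norm (fst p))\<^sup>2 / (4 * (snd p)\<^sup>2) - CARD('n) / (2 * snd p)) - (fst p \<bullet> a) / (2 * snd p)) * ?K p"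
      unfolding 1 2 by (simp add: algebra_simps power2_eq_square)
  qed
  finally show ?thesis .
qed

lemma has_deriv_along_coord:
  fixes v :: "(real^'n) \<times> real"
  assumes "has_deriv_along v P Q"
  shows "has_deriv_along v (\<lambda>p. fst p $ i * P p) (\<lambda>p. fst v $ i * P p + fst p $ i * Q p)"
  unfolding has_deriv_along_def
proof
  fix p :: "(real^'n) \<times> real" assume "p \<in> D0"
  from has_deriv_alongD[OF assms this]
  show "((\<lambda>h. fst (p + h *\<^sub>R v) $ i * P (p + h *\<^sub>R v)) has_real_derivative
      fst v $ i * P p + fst p $ i * Q p) (at 0)"
    by (auto intro!: derivative_eq_intros)
qed

lemma has_deriv_along_over_time:
  fixes v :: "(real^'n) \<times> real"
  assumes "has_deriv_along v P Q"
  shows "has_deriv_along v (\<lambda>p. P p / snd p) (\<lambda>p. - snd v * (P p / snd p / snd p) + Q p / snd p)"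
  unfolding has_deriv_along_def
proof
  fix p :: "(real^'n) \<times> real" assume p: "p \<in> D0"
  then have "snd p \<noteq> 0" by (auto simp: D0_def)
  with has_deriv_alongD[OF assms p]
  show "((\<lambda>h. P (p + h *\<^sub>R v) / snd (p + h *\<^sub>R v)) has_real_derivative
      - snd v * (P p / snd p / snd p) + Q p / snd p) (at 0)"
    by (auto intro!: derivative_eq_intros simp: field_simps)
qed

lemma heat_poly_closed_deriv:
  assumes "heat_poly P"
  shows "\<exists>Q. heat_poly Q \<and> has_deriv_along v P Q"
  using assms
proof induction
  case kernel
  show ?case
    using heat_poly_deriv_heat_kernel[of "snd v" "fst v"] has_deriv_along_heat_kernel[of "fst v" "snd v"]
    by (intro exI conjI) auto
next
  case (coord P i)
  then obtain Q where Q: "heat_poly Q" "has_deriv_along v P Q" by blast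
  from heat_poly.add[OF heat_poly.scale[OF coord.hyps] heat_poly.coord[OF Q(1)]]
    has_deriv_along_coord[OF Q(2)]
  show ?case by (intro exI conjI)
next
  case (over_time P)
  then obtain Q where Q: "heat_poly Q" "has_deriv_along v P Q" by blast
  from heat_poly.add[OF heat_poly.scale[OF heat_poly.over_time[OF heat_poly.over_time[OF over_time.hyps]]]
      heat_poly.over_time[OF Q(1)]] has_deriv_along_over_time[OF Q(2)]
  show ?case by (intro exI conjI)
next
  case (scale P c)
  then obtain Q where Q: "heat_poly Q" "has_deriv_along v P Q" by blast
  have "has_deriv_along v (\<lambda>p. c * P p) (\<lambda>p. c * Q p)"
    using Q(2) unfolding has_deriv_along_def by (auto intro!: DERIV_cmult)
  with heat_poly.scale[OF Q(1)] show ?case by (intro exI conjI)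
next
  case (add P P')
  then obtain Q Q' where Q: "heat_poly Q" "has_deriv_along v P Q" "heat_poly Q'" "has_deriv_along v P' Q'"
    by blast
  have "has_deriv_along v (\<lambda>p. P p + P' p) (\<lambda>p. Q p + Q' p)"
    using Q(2,4) unfolding has_deriv_along_def by (auto intro!: DERIV_add)
  with heat_poly.add[OF Q(1,3)] show ?case by (intro exI conjI)
qed

lemma continuous_on_heat_poly:
  assumes "heat_poly P"
  shows "continuous_on D0 P"
  using assms
proof induction
  case kernel
  show ?case unfolding heat_kernel_def by (intro continuous_intros) (auto simp: D0_def)
qed (auto intro!: continuous_intros simp: D0_def)

lemma abs_coord_weight_le: "\<bar>x $ i\<bar> * weight x \<le> 1"
  for x :: "real^'n"
proof -
  have "\<bar>x $ i\<bar> \<le> (\<Sum>i\<in>UNIV. \<bar>x $ i\<bar>)" by (rule member_le_sum) auto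
  also have "\<dots> \<le> exp (\<Sum>i\<in>UNIV. \<bar>x $ i\<bar>)"
    using exp_ge_add_one_self[of "\<Sum>i\<in>UNIV. \<bar>x $ i\<bar>"] by linarith
  finally have "\<bar>x $ i\<bar> * weight x \<le> exp (\<Sum>i\<in>UNIV. \<bar>x $ i\<bar>) * weight x"
    by (rule mult_right_mono) simp
  then show ?thesis by (simp add: weight_def exp_minus)
qed

text \<open>All powers \<open>N\<close> are treated at once, because each coordinate factor costs one power of the
  weight.\<close>

lemma heat_poly_bound:
  fixes P :: "(real^'n) \<times> real \<Rightarrow> real"
  assumes "heat_poly P" and a: "0 < a"
  shows "\<exists>C\<ge>0. \<forall>x t. a \<le> t \<longrightarrow> t \<le> b \<longrightarrow> \<bar>P (x, t)\<bar> \<le> C * weight x ^ N"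
  using assms(1)
proof (induction arbitrary: N)
  case kernel
  define C where "C = (4 * pi * a) powr (- (real CARD('n) / 2)) * exp (CARD('n) * (b * N\<^sup>2))"
  have "heat_kernel t x \<le> C * weight x ^ N" if t: "a \<le> t" "t \<le> b" for x :: "real^'n" and t
  proof -
    have b: "0 < b" and "0 < t" using t a by linarith+
    \<comment> \<open>Completing the square: a Gaussian of bounded variance is below every exponential.\<close>
    have 1: "- (u\<^sup>2 / (4 * t)) \<le> b * N\<^sup>2 - N * \<bar>u\<bar>" for u :: real
    proof -
      have "u\<^sup>2 / (4 * b) \<le> u\<^sup>2 / (4 * t)" using t \<open>0 < t\<close> by (intro divide_left_mono) auto
      moreover have "0 \<le> (\<bar>u\<bar> - 2 * b * N)\<^sup>2 / (4 * b)" using b by simp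
      moreover have "(\<bar>u\<bar> - 2 * b * N)\<^sup>2 / (4 * b) = u\<^sup>2 / (4 * b) - N * \<bar>u\<bar> + b * N\<^sup>2"
        using b by (simp add: power2_diff field_simps power2_eq_square)
      ultimately show ?thesis by linarith
    qed
    have "- ((norm x)\<^sup>2 / (4 * t)) = (\<Sum>i\<in>UNIV. - ((x $ i)\<^sup>2 / (4 * t)))"
      by (simp add: norm_vec_power2 sum_divide_distrib sum_negf)
    also have "\<dots> \<le> (\<Sum>i\<in>(UNIV :: 'n set). b * N\<^sup>2 - N * \<bar>x $ i\<bar>)" by (intro sum_mono 1)
    also have "\<dots> = CARD('n) * (b * N\<^sup>2) + N * - (\<Sum>i\<in>UNIV. \<bar>x $ i\<bar>)"
      by (simp add: sum_subtractf sum_distrib_left)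
    finally have "exp (- ((norm x)\<^sup>2 / (4 * t))) \<le> exp (CARD('n) * (b * N\<^sup>2)) * weight x ^ N"
      unfolding weight_def exp_of_nat_mult[symmetric] exp_add[symmetric] by simp
    moreover have "(4 * pi * t) powr (- (real CARD('n) / 2)) \<le> (4 * pi * a) powr (- (real CARD('n) / 2))"
      using t a by (intro powr_mono2') auto
    ultimately show ?thesis
      unfolding heat_kernel_def C_def mult.assoc[of "_ powr _"] by (intro mult_mono) auto
  qed
  then show ?case by (intro exI[of _ C]) (auto simp: C_def)
next
  case (coord P i)
  from coord.IH[of "Suc N"] obtain C where C: "0 \<le> C"
    "\<And>x t. a \<le> t \<Longrightarrow> t \<le> b \<Longrightarrow> \<bar>P (x, t)\<bar> \<le> C * weight x ^ Suc N" by blast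
  have "\<bar>x $ i * P (x, t)\<bar> \<le> C * weight x ^ N" if t: "a \<le> t" "t \<le> b" for x t
  proof -
    have "\<bar>x $ i * P (x, t)\<bar> \<le> \<bar>x $ i\<bar> * (C * weight x ^ Suc N)"
      unfolding abs_mult by (intro mult_left_mono C t) simp
    also have "\<dots> = (\<bar>x $ i\<bar> * weight x) * (C * weight x ^ N)" by simp
    also have "\<dots> \<le> 1 * (C * weight x ^ N)"
      by (intro mult_right_mono abs_coord_weight_le) (simp add: C(1))
    finally show ?thesis by simp
  qed
  then show ?case using C(1) by auto
next
  case (over_time P)
  then obtain C where C: "0 \<le> C"
    "\<And>x t. a \<le> t \<Longrightarrow> t \<le> b \<Longrightarrow> \<bar>P (x, t)\<bar> \<le> C * weight x ^ N" by blast
  have "\<bar>P (x, t) / t\<bar> \<le> C / a * weight x ^ N" if t: "a \<le> t" "t \<le> b" for x t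
  proof -
    have "\<bar>P (x, t)\<bar> / t \<le> (C * weight x ^ N) / a"
      using t a C(1) by (intro frac_le C) auto
    then show ?thesis using t a by (simp add: abs_divide)
  qed
  then show ?case using C(1) a by (intro exI[of _ "C / a"]) auto
next
  case (scale P c)
  then obtain C where "0 \<le> C"
    "\<And>x t. a \<le> t \<Longrightarrow> t \<le> b \<Longrightarrow> \<bar>P (x, t)\<bar> \<le> C * weight x ^ N" by blast
  then show ?case by (intro exI[of _ "\<bar>c\<bar> * C"]) (auto simp: abs_mult mult.assoc intro!: mult_left_mono)
next
  case (add P Q)
  then obtain C C' where C: "0 \<le> C" "\<And>x t. a \<le> t \<Longrightarrow> t \<le> b \<Longrightarrow> \<bar>P (x, t)\<bar> \<le> C * weight x ^ N"
    and C': "0 \<le> C'" "\<And>x t. a \<le> t \<Longrightarrow> t \<le> b \<Longrightarrow> \<bar>Q (x, t)\<bar> \<le> C' * weight x ^ N" by meson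
  have "\<bar>P (x, t) + Q (x, t)\<bar> \<le> (C + C') * weight x ^ N" if "a \<le> t" "t \<le> b" for x t
    using C(2)[OF that, of x] C'(2)[OF that, of x] by (simp add: distrib_right)
  then show ?case using C(1) C'(1) by (intro exI[of _ "C + C'"]) auto
qed

lemma weight_ge_exp_norm: "exp (- (CARD('n) * norm x)) \<le> weight x"
  for x :: "real^'n"
proof -
  have "(\<Sum>i\<in>UNIV. \<bar>x $ i\<bar>) \<le> (\<Sum>i\<in>(UNIV :: 'n set). norm x)"
    by (intro sum_mono component_le_norm_cart)
  then show ?thesis by (simp add: weight_def)
qed

lemma weight_diff_le: "weight (x - y) \<le> weight y / weight x"
  using weight_add_ge[of "x - y" "- x"] by (simp add: field_simps)

text \<open>The bound is uniform in a neighbourhood of \<open>p\<close>, as dominated convergence at \<open>p\<close> requires; moving the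
  space variable by at most \<open>1\<close> changes the weight at most by the factor \<open>exp (- CARD('n))\<close>.\<close>

lemma heat_poly_locally_bounded:
  fixes P :: "(real^'n) \<times> real \<Rightarrow> real"
  assumes P: "heat_poly P" and p: "p \<in> D0"
  obtains \<delta> C where "0 < \<delta>" "ball p \<delta> \<subseteq> D0"
    "\<forall>q\<in>ball p \<delta>. \<forall>y. \<bar>P (fst q - y, snd q)\<bar> \<le> C * weight y"
proof -
  obtain x t where xt: "p = (x, t)" and t: "0 < t" using p by (cases p) (auto simp: D0_def)
  from heat_poly_bound[OF P, of "t / 2" "2 * t" 1] t obtain C where C: "0 \<le> C"
    "\<And>x s. t / 2 \<le> s \<Longrightarrow> s \<le> 2 * t \<Longrightarrow> \<bar>P (x, s)\<bar> \<le> C * weight x" by auto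
  define \<delta> where "\<delta> = min 1 (t / 2)"
  define c where "c = weight x * exp (- real CARD('n))"
  have near: "norm (fst q - x) \<le> 1" "t / 2 \<le> snd q" "snd q \<le> 2 * t" "0 < snd q" if "q \<in> ball p \<delta>" for q
  proof -
    have "dist x (fst q) < \<delta>" "dist t (snd q) < \<delta>"
      using that dist_fst_le[of p q] dist_snd_le[of p q] by (auto simp: xt)
    then have "norm (fst q - x) \<le> 1" "\<bar>t - snd q\<bar> < t / 2"
      by (auto simp: \<delta>_def dist_norm norm_minus_commute dist_real_def)
    then show "norm (fst q - x) \<le> 1" "t / 2 \<le> snd q" "snd q \<le> 2 * t" "0 < snd q"
      using t by linarith+
  qed
  show ?thesis
  proof (rule that[of \<delta> "C / c"])
    show "0 < \<delta>" using t by (simp add: \<delta>_def)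
    show "ball p \<delta> \<subseteq> D0" using near(4) by (auto simp: D0_def mem_Times_iff)
    show "\<forall>q\<in>ball p \<delta>. \<forall>y. \<bar>P (fst q - y, snd q)\<bar> \<le> C / c * weight y"
    proof (intro ballI allI)
      fix q y assume q: "q \<in> ball p \<delta>"
      have "exp (- real CARD('n)) \<le> exp (- (CARD('n) * norm (fst q - x)))"
        using near(1)[OF q] by (simp add: mult_left_le)
      also have "\<dots> \<le> weight (fst q - x)" by (rule weight_ge_exp_norm)
      finally have "c \<le> weight x * weight (fst q - x)"
        unfolding c_def by (intro mult_left_mono) auto
      also have "\<dots> \<le> weight (fst q)" using weight_add_ge[of x "fst q - x"] by simp
      finally have c: "c \<le> weight (fst q)" .
      have "0 < c" by (simp add: c_def)
      have "\<bar>P (fst q - y, snd q)\<bar> \<le> C * weight (fst q - y)" using C(2) near[OF q] by blast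
      also have "\<dots> \<le> C * (weight y / weight (fst q))" by (intro mult_left_mono weight_diff_le C)
      also have "\<dots> \<le> C * (weight y / c)"
        using c \<open>0 < c\<close> by (intro mult_left_mono divide_left_mono C) auto
      finally show "\<bar>P (fst q - y, snd q)\<bar> \<le> C / c * weight y" by simp
    qed
  qed
qed

section \<open>Solutions given by integrals against the heat kernel\<close>

lemma integral_dominated_convergence_at:
  fixes f :: "'a::first_countable_topology \<Rightarrow> 'b \<Rightarrow> real"
  assumes bound: "\<forall>\<^sub>F q in at a. f q \<in> borel_measurable M \<and> (\<forall>x. \<bar>f q x\<bar> \<le> w x)"
    and lim: "\<And>x. ((\<lambda>q. f q x) \<longlongrightarrow> f0 x) (at a)"
    and w: "integrable M w" and f0: "f0 \<in> borel_measurable M"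
  shows "((\<lambda>q. \<integral>x. f q x \<partial>M) \<longlongrightarrow> (\<integral>x. f0 x \<partial>M)) (at a)"
  unfolding tendsto_at_iff_sequentially comp_def
proof (intro allI impI)
  fix X :: "nat \<Rightarrow> 'a" assume "\<forall>i. X i \<in> UNIV - {a}" and X: "X \<longlonglongrightarrow> a"
  then have at: "filterlim X (at a) sequentially"
    by (simp add: filterlim_at)
  from eventually_compose_filterlim[OF bound at] obtain N where N:
    "\<And>n. n \<ge> N \<Longrightarrow> f (X n) \<in> borel_measurable M \<and> (\<forall>x. \<bar>f (X n) x\<bar> \<le> w x)"
    by (auto simp: eventually_sequentially)
  show "(\<lambda>n. \<integral>x. f (X n) x \<partial>M) \<longlonglongrightarrow> (\<integral>x. f0 x \<partial>M)"
  proof (rule LIMSEQ_offset[where k = N], rule integral_dominated_convergence[OF f0 _ w])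
    show "AE x in M. (\<lambda>n. f (X (n + N)) x) \<longlonglongrightarrow> f0 x"
      using filterlim_compose[OF lim at] by (intro AE_I2 LIMSEQ_ignore_initial_segment)
  qed (use N in auto)
qed

text \<open>Initial data that can be integrated against every kernel of the class.\<close>

definition weighted_integrable :: "(real^'n \<Rightarrow> real) \<Rightarrow> bool"
  where "weighted_integrable g \<longleftrightarrow> integrable lborel (\<lambda>y. weight y * g y)"

lemma weighted_integrable_measurable:
  assumes "weighted_integrable g"
  shows "g \<in> borel_measurable borel"
proof -
  have "(\<lambda>y. weight y * g y / weight y) \<in> borel_measurable borel"
    using borel_measurable_integrable[OF assms[unfolded weighted_integrable_def]]
    by (intro borel_measurable_divide) auto
  then show ?thesis by simp
qed

lemma weighted_integrable_abs:
  "weighted_integrable g \<Longrightarrow> integrable lborel (\<lambda>y. C * weight y * \<bar>g y\<bar>)"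
proof -
  assume "weighted_integrable g"
  then have "integrable lborel (\<lambda>y. C * \<bar>weight y * g y\<bar>)"
    unfolding weighted_integrable_def by (intro integrable_mult_right integrable_abs)
  then show ?thesis by (simp add: abs_mult mult.assoc)
qed

definition kernel_ext ::
    "((real^'n) \<times> real \<Rightarrow> real) \<Rightarrow> (real^'n \<Rightarrow> real) \<Rightarrow> (real^'n) \<times> real \<Rightarrow> real"
  where "kernel_ext P g p = (\<integral>y. P (fst p - y, snd p) * g y \<partial>lborel)"

lemma measurable_heat_poly_translate:
  assumes "heat_poly P" "0 < t"
  shows "(\<lambda>y. P (x - y, t)) \<in> borel_measurable borel"
proof (rule borel_measurable_continuous_onI)
  show "continuous_on UNIV (\<lambda>y. P (x - y, t))"
    by (rule continuous_on_compose2[OF continuous_on_heat_poly[OF assms(1)]])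
      (auto intro!: continuous_intros simp: D0_def assms(2))
qed

lemma integrable_kernel_ext:
  assumes P: "heat_poly P" and g: "weighted_integrable g" and p: "p \<in> D0"
  shows "integrable lborel (\<lambda>y. P (fst p - y, snd p) * g y)"
proof -
  note [measurable] = weighted_integrable_measurable[OF g]
  have t: "0 < snd p" using p by (auto simp: D0_def)
  note [measurable] = measurable_heat_poly_translate[OF P t]
  obtain \<delta> C where C: "0 < \<delta>" "\<forall>q\<in>ball p \<delta>. \<forall>y. \<bar>P (fst q - y, snd q)\<bar> \<le> C * weight y"
    by (rule heat_poly_locally_bounded[OF P p])
  have "\<bar>P (fst p - y, snd p) * g y\<bar> \<le> C * weight y * \<bar>g y\<bar>" for y
    unfolding abs_mult using C by (intro mult_right_mono) auto
  then show ?thesis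
    by (intro Bochner_Integration.integrable_bound[OF weighted_integrable_abs[OF g, of C]])
      (auto intro: order_trans[OF _ abs_ge_self])
qed

lemma tendsto_translate_at:
  fixes P :: "(real^'n) \<times> real \<Rightarrow> real"
  assumes "continuous_on D0 P" "p \<in> D0"
  shows "((\<lambda>q. P (fst q - y, snd q)) \<longlongrightarrow> P (fst p - y, snd p)) (at p)"
proof -
  have "continuous_on D0 (\<lambda>q. P (fst q - y, snd q))"
    by (rule continuous_on_compose2[OF assms(1)]) (auto intro!: continuous_intros simp: D0_def)
  then have "isCont (\<lambda>q. P (fst q - y, snd q)) p"
    using assms(2) unfolding continuous_on_eq_continuous_at[OF open_D0] by blast
  then show ?thesis unfolding isCont_def .
qed

lemma continuous_on_kernel_ext:
  assumes P: "heat_poly P" and g: "weighted_integrable g"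
  shows "continuous_on D0 (kernel_ext P g)"
  unfolding continuous_on_eq_continuous_at[OF open_D0] isCont_def
proof
  fix p :: "(real^'a) \<times> real" assume p: "p \<in> D0"
  obtain \<delta> C where C: "0 < \<delta>" "ball p \<delta> \<subseteq> D0"
    "\<forall>q\<in>ball p \<delta>. \<forall>y. \<bar>P (fst q - y, snd q)\<bar> \<le> C * weight y"
    by (rule heat_poly_locally_bounded[OF P p])
  show "(kernel_ext P g \<longlongrightarrow> kernel_ext P g p) (at p)"
    unfolding kernel_ext_def
  proof (rule integral_dominated_convergence_at)
    have "\<forall>\<^sub>F q in at p. q \<in> ball p \<delta>"
      using C(1) by (intro eventually_at_in_open') auto
    then show "\<forall>\<^sub>F q in at p. (\<lambda>y. P (fst q - y, snd q) * g y) \<in> borel_measurable lborel \<and>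
        (\<forall>y. \<bar>P (fst q - y, snd q) * g y\<bar> \<le> C * weight y * \<bar>g y\<bar>)"
    proof eventually_elim
      case (elim q)
      then show ?case
        using borel_measurable_integrable[OF integrable_kernel_ext[OF P g]] C
        by (auto simp: abs_mult intro!: mult_right_mono)
    qed
    show "((\<lambda>q. P (fst q - y, snd q) * g y) \<longlongrightarrow> P (fst p - y, snd p) * g y) (at p)" for y
      by (intro tendsto_mult tendsto_const tendsto_translate_at continuous_on_heat_poly P p)
  qed (use integrable_kernel_ext[OF P g p] weighted_integrable_abs[OF g] in auto)
qed

text \<open>Differentiation under the integral sign: by the mean value theorem the difference quotients of
  \<open>P\<close> satisfy the same local bound as its derivative \<open>Q\<close>.\<close>

lemma has_deriv_along_kernel_ext:
  fixes v :: "(real^'n) \<times> real"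
  assumes P: "heat_poly P" and Q: "heat_poly Q" and PQ: "has_deriv_along v P Q"
    and g: "weighted_integrable g"
  shows "has_deriv_along v (kernel_ext P g) (kernel_ext Q g)"
  unfolding has_deriv_along_def
proof
  fix p :: "(real^'n) \<times> real" assume p: "p \<in> D0"
  obtain \<delta> C where C: "0 < \<delta>" "ball p \<delta> \<subseteq> D0"
    "\<forall>q\<in>ball p \<delta>. \<forall>y. \<bar>Q (fst q - y, snd q)\<bar> \<le> C * weight y"
    by (rule heat_poly_locally_bounded[OF Q p])
  define \<eta> where "\<eta> = \<delta> / (norm v + 1)"
  have nv: "0 < norm v + 1" by (simp add: add_nonneg_pos)
  have \<eta>: "0 < \<eta>" using C(1) nv by (simp add: \<eta>_def)
  have near: "p + s *\<^sub>R v \<in> ball p \<delta>" if "\<bar>s\<bar> < \<eta>" for s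
  proof -
    have "\<bar>s\<bar> * norm v \<le> \<bar>s\<bar> * (norm v + 1)" by (intro mult_left_mono) auto
    also have "\<dots> < \<delta>" using that nv by (simp add: \<eta>_def field_simps)
    finally show ?thesis by (simp add: dist_norm)
  qed
  define F where "F y s = P (fst (p + s *\<^sub>R v) - y, snd (p + s *\<^sub>R v))" for y s
  have F: "(F y has_real_derivative Q (fst (p + s *\<^sub>R v) - y, snd (p + s *\<^sub>R v))) (at s)"
    if s: "\<bar>s\<bar> < \<eta>" for y s
  proof -
    have "(fst (p + s *\<^sub>R v) - y, snd (p + s *\<^sub>R v)) \<in> D0"
      using subsetD[OF C(2) near[OF s]] by (simp add: D0_def mem_Times_iff)
    moreover have "F y (h + s) = P ((fst (p + s *\<^sub>R v) - y, snd (p + s *\<^sub>R v)) + h *\<^sub>R v)" for h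
      by (simp add: F_def plus_prod_def scaleR_prod_def algebra_simps)
    ultimately have "((\<lambda>h. F y (h + s)) has_real_derivative Q (fst (p + s *\<^sub>R v) - y, snd (p + s *\<^sub>R v))) (at 0)"
      using has_deriv_alongD[OF PQ] by simp
    then show ?thesis using DERIV_shift[of "F y" _ 0 s] by simp
  qed
  have quot: "\<bar>(F y h - F y 0) / h\<bar> \<le> C * weight y" if h: "h \<noteq> 0" "\<bar>h\<bar> < \<eta>" for y h
  proof -
    have "norm (F y h - F y 0) \<le> (C * weight y) * norm (h - 0)"
    proof (rule field_differentiable_bound)
      fix s :: real assume "s \<in> ball 0 \<eta>"
      then have s: "\<bar>s\<bar> < \<eta>" by simp
      show "(F y has_real_derivative Q (fst (p + s *\<^sub>R v) - y, snd (p + s *\<^sub>R v))) (at s within ball 0 \<eta>)"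
        using F[OF s] by (rule has_field_derivative_at_within)
      show "norm (Q (fst (p + s *\<^sub>R v) - y, snd (p + s *\<^sub>R v))) \<le> C * weight y"
        using bspec[OF C(3) near[OF s]] by (simp del: fst_add snd_add)
    qed (use h \<eta> in auto)
    then show ?thesis using h by (simp add: field_simps)
  qed
  have int: "integrable lborel (\<lambda>y. F y s * g y)" if "\<bar>s\<bar> < \<eta>" for s
    unfolding F_def using near[OF that] C(2) by (intro integrable_kernel_ext P g) auto
  have ext: "kernel_ext P g (p + s *\<^sub>R v) = (\<integral>y. F y s * g y \<partial>lborel)" for s
    by (simp add: kernel_ext_def F_def)
  have small: "\<forall>\<^sub>F h in at 0. h \<noteq> 0 \<and> \<bar>h\<bar> < \<eta>"
    unfolding eventually_at using \<eta> by (intro exI[of _ \<eta>]) auto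
  have "((\<lambda>h. \<integral>y. (F y h - F y 0) / h * g y \<partial>lborel) \<longlongrightarrow> (\<integral>y. Q (fst p - y, snd p) * g y \<partial>lborel)) (at 0)"
  proof (rule integral_dominated_convergence_at)
    show "\<forall>\<^sub>F h in at 0. (\<lambda>y. (F y h - F y 0) / h * g y) \<in> borel_measurable lborel \<and>
        (\<forall>y. \<bar>(F y h - F y 0) / h * g y\<bar> \<le> C * weight y * \<bar>g y\<bar>)"
      using small
    proof eventually_elim
      case (elim h)
      have "integrable lborel (\<lambda>y. (F y h * g y - F y 0 * g y) / h)"
        using int[of h] int[of 0] elim \<eta> by auto
      moreover have "(\<lambda>y. (F y h * g y - F y 0 * g y) / h) = (\<lambda>y. (F y h - F y 0) / h * g y)"
        by (simp add: fun_eq_iff diff_divide_distrib left_diff_distrib)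
      ultimately have "(\<lambda>y. (F y h - F y 0) / h * g y) \<in> borel_measurable lborel"
        using borel_measurable_integrable by metis
      moreover have "\<bar>(F y h - F y 0) / h * g y\<bar> \<le> C * weight y * \<bar>g y\<bar>" for y
        unfolding abs_mult[of _ "g y"] using elim by (intro mult_right_mono quot) auto
      ultimately show ?case by (intro conjI allI)
    qed
    show "((\<lambda>h. (F y h - F y 0) / h * g y) \<longlongrightarrow> Q (fst p - y, snd p) * g y) (at 0)" for y
      using F[of 0 y] \<eta> by (intro tendsto_mult tendsto_const) (simp add: DERIV_def)
  qed (use integrable_kernel_ext[OF Q g p] weighted_integrable_abs[OF g] in auto)
  moreover have "\<forall>\<^sub>F h in at 0. (\<integral>y. (F y h - F y 0) / h * g y \<partial>lborel) =
      (kernel_ext P g (p + (0 + h) *\<^sub>R v) - kernel_ext P g (p + 0 *\<^sub>R v)) / h"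
    using small
  proof eventually_elim
    case (elim h)
    have "(\<integral>y. (F y h - F y 0) / h * g y \<partial>lborel) = (\<integral>y. (F y h * g y - F y 0 * g y) / h \<partial>lborel)"
      by (simp add: diff_divide_distrib left_diff_distrib)
    also have "\<dots> = ((\<integral>y. F y h * g y \<partial>lborel) - (\<integral>y. F y 0 * g y \<partial>lborel)) / h"
      using int[of h] int[of 0] elim \<eta> by simp
    finally show ?case unfolding ext by simp
  qed
  ultimately show "((\<lambda>h. kernel_ext P g (p + h *\<^sub>R v)) has_real_derivative kernel_ext Q g p) (at 0)"
    unfolding DERIV_def kernel_ext_def[of Q] by (rule Lim_transform_eventually)
qed

lemma kernel_ext_sum:
  assumes "finite I" "\<And>i. i \<in> I \<Longrightarrow> heat_poly (P i)" "weighted_integrable g" "p \<in> D0"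
  shows "kernel_ext (\<lambda>q. \<Sum>i\<in>I. P i q) g p = (\<Sum>i\<in>I. kernel_ext (P i) g p)"
  unfolding kernel_ext_def sum_distrib_right
  using integrable_kernel_ext[OF assms(2,3,4)] by (intro Bochner_Integration.integral_sum) auto

abbreviation heat_kernel_pair :: "(real^'n) \<times> real \<Rightarrow> real"
  where "heat_kernel_pair p \<equiv> heat_kernel (snd p) (fst p)"

text \<open>Fubini and the semigroup property of the kernel.\<close>

lemma kernel_ext_heat_semigroup:
  assumes g: "weighted_integrable g" and s: "0 < s" and t: "0 < t"
  shows "has_bochner_integral lborel
    (\<lambda>y. heat_kernel s (x - y) * kernel_ext heat_kernel_pair g (y, t))
    (kernel_ext heat_kernel_pair g (x, s + t))"
proof -
  note [measurable] = weighted_integrable_measurable[OF g]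
  define f where "f z y = heat_kernel s (x - y) * heat_kernel t (y - z) * g z" for z y
  have f_meas [measurable]: "case_prod f \<in> borel_measurable (lborel \<Otimes>\<^sub>M lborel)"
    unfolding f_def by measurable
  note conv = has_bochner_integral_heat_kernel_conv[OF s t, of x]
  have fz: "has_bochner_integral lborel (f z) (heat_kernel (s + t) (x - z) * g z)" for z
    unfolding f_def by (rule has_bochner_integral_mult_left[OF conv])
  have fz': "has_bochner_integral lborel (\<lambda>y. norm (f z y)) (heat_kernel (s + t) (x - z) * \<bar>g z\<bar>)" for z
    unfolding f_def real_norm_def abs_mult abs_of_nonneg[OF heat_kernel_nonneg]
    by (rule has_bochner_integral_mult_left[OF conv])
  have st: "(x, s + t) \<in> D0" using s t by (simp add: D0_def)
  have "integrable lborel (\<lambda>z. heat_kernel (s + t) (x - z) * \<bar>g z\<bar>)"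
    using integrable_abs[OF integrable_kernel_ext[OF heat_poly.kernel g st]] by (simp add: abs_mult)
  then have int: "integrable (lborel \<Otimes>\<^sub>M lborel) (case_prod f)"
    using fz fz'
    by (intro lborel_pair.Fubini_integrable f_meas)
      (auto simp: has_bochner_integral_iff)
  have y: "(\<integral>z. f z y \<partial>lborel) = heat_kernel s (x - y) * kernel_ext heat_kernel_pair g (y, t)" for y
    by (simp add: f_def kernel_ext_def mult.assoc)
  have "(\<integral>y. (\<integral>z. f z y \<partial>lborel) \<partial>lborel) = (\<integral>z. (\<integral>y. f z y \<partial>lborel) \<partial>lborel)"
    by (rule lborel_pair.Fubini_integral[OF int])
  also have "\<dots> = (\<integral>z. heat_kernel (s + t) (x - z) * g z \<partial>lborel)"
    using fz by (simp add: has_bochner_integral_iff)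
  finally show ?thesis
    using lborel_pair.integrable_snd[OF int] unfolding y
    by (simp add: has_bochner_integral_iff kernel_ext_def)
qed

section \<open>Smoothness, heat equation and semigroup property of represented functions\<close>

definition slice_time :: "nat \<Rightarrow> real"
  where "slice_time m = 1 / real (Suc m)"

lemma slice_time_pos [simp]: "0 < slice_time m"
  by (simp add: slice_time_def)

lemma slice_time_less:
  assumes "0 < t"
  obtains m where "slice_time m < t"
  using assms nat_approx_posE unfolding slice_time_def by blast

text \<open>Here \<open>g m\<close> is data at time \<open>slice_time m\<close>, from which \<open>u\<close> is computed at all later times. The times
  decrease to zero, so every point of \<open>D0\<close> is later than some slice. The data \<open>g\<close> is kept when \<open>u\<close>
  is differentiated: only the kernel \<open>P\<close> is replaced by its derivative.\<close>

definition heat_represented ::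
    "(nat \<Rightarrow> real^'n \<Rightarrow> real) \<Rightarrow> ((real^'n) \<times> real \<Rightarrow> real) \<Rightarrow> ((real^'n) \<times> real \<Rightarrow> real) \<Rightarrow> bool"
  where "heat_represented g P u \<longleftrightarrow>
    (\<forall>m q. slice_time m < snd q \<longrightarrow> u q = kernel_ext P (g m) (fst q, snd q - slice_time m))"

lemma D0_slice_time_less:
  assumes "p \<in> D0"
  obtains m where "slice_time m < snd p"
  using assms slice_time_less[of "snd p"] by (auto simp: D0_def mem_Times_iff)

lemma heat_represented_continuous_on:
  fixes u :: "(real^'n) \<times> real \<Rightarrow> real"
  assumes u: "heat_represented g P u" and P: "heat_poly P" and g: "\<And>m. weighted_integrable (g m)"
  shows "continuous_on D0 u"
  unfolding continuous_on_eq_continuous_at[OF open_D0]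
proof
  fix p :: "(real^'n) \<times> real" assume "p \<in> D0"
  then obtain m where m: "slice_time m < snd p" by (rule D0_slice_time_less)
  let ?S = "UNIV \<times> {slice_time m<..} :: ((real^'n) \<times> real) set"
  have "continuous_on ?S (\<lambda>q. kernel_ext P (g m) (fst q, snd q - slice_time m))"
    by (rule continuous_on_compose2[OF continuous_on_kernel_ext[OF P g]])
      (auto intro!: continuous_intros simp: D0_def)
  then have "continuous_on ?S u"
    by (rule continuous_on_eq) (use u in \<open>auto simp: heat_represented_def\<close>)
  moreover have "open ?S" by (intro open_Times) auto
  moreover have "p \<in> ?S" using m by (simp add: mem_Times_iff)
  ultimately show "isCont u p" using continuous_on_eq_continuous_at by blast
qed

text \<open>Differentiability and derivatives are local, so it suffices to work after a single slice.\<close>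

lemma heat_represented_deriv:
  fixes u :: "(real^'n) \<times> real \<Rightarrow> real"
  assumes u: "heat_represented g P u" and P: "heat_poly P" and Q: "heat_poly Q"
    and PQ: "has_deriv_along v P Q" and g: "\<And>m. weighted_integrable (g m)"
  shows "\<forall>p\<in>D0. has_partial v u p" and "heat_represented g Q (partial v u)"
proof -
  have deriv: "((\<lambda>h. u (p + h *\<^sub>R v)) has_real_derivative
      kernel_ext Q (g m) (fst p, snd p - slice_time m)) (at 0)"
    if m: "slice_time m < snd p" for p m
  proof -
    let ?p = "(fst p, snd p - slice_time m)"
    let ?S = "(\<lambda>h. snd p + h * snd v) -` {slice_time m<..}"
    have "?p \<in> D0" using m by (simp add: D0_def)
    from has_deriv_alongD[OF has_deriv_along_kernel_ext[OF P Q PQ g] this]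
    show ?thesis
    proof (rule has_field_derivative_transform_within_open)
      show "open ?S" by (intro open_vimage open_greaterThan continuous_intros)
      show "0 \<in> ?S" using m by simp
      fix h assume "h \<in> ?S"
      then have "slice_time m < snd (p + h *\<^sub>R v)" by simp
      then have "u (p + h *\<^sub>R v) = kernel_ext P (g m) (fst (p + h *\<^sub>R v), snd (p + h *\<^sub>R v) - slice_time m)"
        using u unfolding heat_represented_def by blast
      then show "kernel_ext P (g m) (?p + h *\<^sub>R v) = u (p + h *\<^sub>R v)"
        by (simp add: plus_prod_def scaleR_prod_def algebra_simps)
    qed
  qed
  show "\<forall>p\<in>D0. has_partial v u p"
    unfolding has_partial_def using deriv D0_slice_time_less field_differentiable_def by metis
  show "heat_represented g Q (partial v u)"
    unfolding heat_represented_def partial_def using deriv DERIV_imp_deriv by blast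
qed

text \<open>Induction on the order, for all kernels of the class at once.\<close>

lemma heat_represented_Ck_on:
  fixes u :: "(real^'n) \<times> real \<Rightarrow> real"
  assumes "heat_represented g P u" "heat_poly P" "\<And>m. weighted_integrable (g m)"
  shows "Ck_on k D0 u"
  using assms(1,2)
proof (induction k arbitrary: P u)
  case 0
  then show ?case using heat_represented_continuous_on assms(3) by auto
next
  case (Suc k)
  have "(\<forall>p\<in>D0. has_partial b u p) \<and> Ck_on k D0 (partial b u)" for b
  proof -
    obtain Q where Q: "heat_poly Q" "has_deriv_along b P Q"
      using heat_poly_closed_deriv[OF Suc.prems(2)] by blast
    from heat_represented_deriv[OF Suc.prems(1,2) Q assms(3)] Suc.IH[OF _ Q(1)] show ?thesis by blast
  qed
  then show ?case
    using heat_represented_continuous_on[OF Suc.prems assms(3)] by simp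
qed

lemma heat_represented_partial:
  fixes u :: "(real^'n) \<times> real \<Rightarrow> real"
  assumes "heat_represented g P u" "heat_poly P" "\<And>m. weighted_integrable (g m)"
  obtains Q where "heat_poly Q" "heat_represented g Q (partial v u)" "\<forall>p\<in>D0. has_partial v u p"
    "continuous_on D0 (partial v u)"
proof -
  obtain Q where Q: "heat_poly Q" "has_deriv_along v P Q"
    using heat_poly_closed_deriv[OF assms(2)] by blast
  note d = heat_represented_deriv[OF assms(1,2) Q assms(3)]
  show ?thesis
    by (rule that[OF Q(1) d(2,1) heat_represented_continuous_on[OF d(2) Q(1) assms(3)]])
qed

lemma heat_represented_C21:
  fixes u :: "(real^'n) \<times> real \<Rightarrow> real"
  assumes u: "heat_represented g P u" and P: "heat_poly P" and g: "\<And>m. weighted_integrable (g m)"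
    and "u \<in> extensional D0"
  shows "u \<in> C21"
proof -
  have "(\<forall>p\<in>D0. has_partial v u p) \<and> continuous_on D0 (partial v u)" for v
    using heat_represented_partial[OF u P g, of v] by metis
  moreover have "(\<forall>p\<in>D0. has_partial w (partial v u) p) \<and> continuous_on D0 (partial w (partial v u))" for v w
  proof -
    obtain Q where Q: "heat_poly Q" "heat_represented g Q (partial v u)"
      using heat_represented_partial[OF u P g, of v] by metis
    show ?thesis using heat_represented_partial[OF Q(2,1) g, of w] by metis
  qed
  ultimately show ?thesis
    using assms(4) heat_represented_continuous_on[OF u P g] unfolding C21_def by blast
qed

text \<open>Both sides are integrals of the same data \<open>g m\<close>, against the time derivative and the Laplacian of the
  heat kernel; these kernels coincide.\<close>

lemma heat_represented_heat_equation:
  fixes u :: "(real^'n) \<times> real \<Rightarrow> real"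
  assumes u: "heat_represented g heat_kernel_pair u" and g: "\<And>m. weighted_integrable (g m)" and p: "p \<in> D0"
  shows "partial e_time u p = laplacian_x u p"
proof -
  let ?K = "heat_kernel_pair :: (real^'n) \<times> real \<Rightarrow> real"
  define T :: "(real^'n) \<times> real \<Rightarrow> real" where
    "T q = ((norm (fst q))\<^sup>2 / (4 * (snd q)\<^sup>2) - CARD('n) / (2 * snd q)) * ?K q" for q
  define X :: "'n \<Rightarrow> (real^'n) \<times> real \<Rightarrow> real" where "X i q = - (1 / 2) * (fst q $ i * ?K q / snd q)" for i q
  define Y :: "'n \<Rightarrow> (real^'n) \<times> real \<Rightarrow> real" where
    "Y i q = 1 / 4 * (fst q $ i * (fst q $ i * ?K q) / snd q / snd q) + - (1 / 2) * (?K q / snd q)" for i q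
  have T: "heat_poly T" "has_deriv_along e_time ?K T"
    using heat_poly_deriv_heat_kernel[of 1 "0 :: real^'n"] has_deriv_along_heat_kernel[of "0 :: real^'n" 1]
    by (simp_all add: e_time_def T_def[abs_def])
  have X: "heat_poly (X i)" "has_deriv_along (e_space i) ?K (X i)" for i
  proof -
    show "heat_poly (X i)" unfolding X_def by (intro heat_poly.intros)
    show "has_deriv_along (e_space i) ?K (X i)"
      using has_deriv_along_heat_kernel[of "axis i 1" 0]
      by (simp add: e_space_def X_def[abs_def] inner_axis)
  qed
  have Y: "heat_poly (Y i)" "has_deriv_along (e_space i) (X i) (Y i)" for i
  proof -
    show "heat_poly (Y i)" unfolding Y_def by (intro heat_poly.intros)
    have 1: "has_deriv_along (e_space i) (\<lambda>q. fst q $ i * ?K q)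
        (\<lambda>q. fst (e_space i) $ i * ?K q + fst q $ i * X i q)"
      by (rule has_deriv_along_coord[OF X(2)])
    have 2: "has_deriv_along (e_space i) (\<lambda>q. fst q $ i * ?K q / snd q)
        (\<lambda>q. - snd (e_space i :: (real^'n) \<times> real) * (fst q $ i * ?K q / snd q / snd q)
          + (fst (e_space i) $ i * ?K q + fst q $ i * X i q) / snd q)"
      by (rule has_deriv_along_over_time[OF 1])
    have "((\<lambda>h. X i (q + h *\<^sub>R e_space i)) has_real_derivative Y i q) (at 0)" if "q \<in> D0" for q
    proof -
      have "- (1 / 2) * (- snd (e_space i :: (real^'n) \<times> real) * (fst q $ i * ?K q / snd q / snd q)
          + (fst (e_space i) $ i * ?K q + fst q $ i * X i q) / snd q) = Y i q"
        by (simp add: X_def Y_def e_space_def add_divide_distrib diff_divide_distrib)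
      then show ?thesis
        using DERIV_cmult[OF has_deriv_alongD[OF 2 that], of "- (1 / 2)"] unfolding X_def by simp
    qed
    then show "has_deriv_along (e_space i) (X i) (Y i)" unfolding has_deriv_along_def by blast
  qed
  have TY: "T q = (\<Sum>i\<in>UNIV. Y i q)" for q
  proof -
    have "(\<Sum>i\<in>UNIV. Y i q) = (\<Sum>i\<in>UNIV. (fst q $ i)\<^sup>2) * (?K q / (4 * (snd q)\<^sup>2)) - CARD('n) * (?K q / (2 * snd q))"
      unfolding Y_def sum.distrib sum_distrib_right by (simp add: power2_eq_square mult.assoc sum_negf)
    also have "\<dots> = T q"
      unfolding T_def norm_vec_power2 by (simp add: left_diff_distrib)
    finally show ?thesis by simp
  qed
  obtain m where m: "slice_time m < snd p" using p by (rule D0_slice_time_less)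
  let ?p = "(fst p, snd p - slice_time m)"
  have p': "?p \<in> D0" using m by (simp add: D0_def)
  have "partial e_time u p = kernel_ext T (g m) ?p"
    using heat_represented_deriv(2)[OF u heat_poly.kernel T g] m unfolding heat_represented_def by blast
  also have "\<dots> = kernel_ext (\<lambda>q. \<Sum>i\<in>UNIV. Y i q) (g m) ?p"
    by (simp add: TY[abs_def])
  also have "\<dots> = (\<Sum>i\<in>UNIV. kernel_ext (Y i) (g m) ?p)"
    by (rule kernel_ext_sum[OF finite Y(1) g p'])
  also have "\<dots> = laplacian_x u p"
    unfolding laplacian_x_def
  proof (rule sum.cong[OF refl])
    fix i
    have "heat_represented g (X i) (partial (e_space i) u)"
      by (rule heat_represented_deriv(2)[OF u heat_poly.kernel X g])
    then have "heat_represented g (Y i) (partial (e_space i) (partial (e_space i) u))"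
      by (rule heat_represented_deriv(2)[OF _ X(1) Y g])
    then show "kernel_ext (Y i) (g m) ?p = partial (e_space i) (partial (e_space i) u) p"
      using m unfolding heat_represented_def by (metis (no_types))
  qed
  finally show ?thesis .
qed

lemma heat_represented_semigroup:
  assumes u: "heat_represented g heat_kernel_pair u" and g: "\<And>m. weighted_integrable (g m)"
    and t: "0 < t1" "t1 < t2"
  shows "has_bochner_integral lborel (\<lambda>y. heat_kernel (t2 - t1) (x - y) * u (y, t1)) (u (x, t2))"
proof -
  obtain m where m: "slice_time m < t1" using t(1) by (rule slice_time_less)
  have "u (y, s) = kernel_ext heat_kernel_pair (g m) (y, s - slice_time m)" if "t1 \<le> s" for y s
    using u m that unfolding heat_represented_def by force
  then show ?thesis
    using kernel_ext_heat_semigroup[OF g[of m], of "t2 - t1" "t1 - slice_time m" x] m t by simp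
qed

section \<open>Series of independent standard normal variables\<close>

text \<open>As an image of the standard normal law, the family includes the degenerate case \<open>\<sigma> = 0\<close> without a case
  distinction.\<close>

definition centered_normal :: "real \<Rightarrow> real measure"
  where "centered_normal \<sigma> = distr std_normal_distribution borel (\<lambda>x. \<sigma> * x)"

lemma real_distribution_centered_normal: "real_distribution (centered_normal \<sigma>)"
proof -
  interpret real_distribution std_normal_distribution by (rule real_dist_normal_dist)
  show ?thesis unfolding centered_normal_def by (rule real_distribution_distr) simp
qed

lemma centered_normal_eq_density:
  assumes "0 \<le> \<sigma>"
  shows "centered_normal \<sigma> =
    (if \<sigma> = 0 then return borel 0 else density lborel (\<lambda>x. ennreal (normal_density 0 \<sigma> x)))"
proof -
  interpret real_distribution std_normal_distribution by (rule real_dist_normal_dist)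
  show ?thesis
  proof (cases "\<sigma> = 0")
    case True
    then show ?thesis by (simp add: centered_normal_def)
  next
    case False
    have "distributed std_normal_distribution lborel (\<lambda>x. x) std_normal_density"
      unfolding distributed_def by (simp add: distr_id2)
    from normal_density_affine[OF this, of \<sigma> 0] False assms
    have "distr std_normal_distribution lborel (\<lambda>x. \<sigma> * x) = density lborel (\<lambda>x. ennreal (normal_density 0 \<sigma> x))"
      by (simp add: distributed_def)
    moreover have "distr std_normal_distribution lborel (\<lambda>x. \<sigma> * x) = centered_normal \<sigma>"
      unfolding centered_normal_def by (rule distr_cong) auto
    ultimately show ?thesis using False by simp
  qed
qed

lemma char_centered_normal:
  "char (centered_normal \<sigma>) u = complex_of_real (exp (- ((\<sigma> * u)\<^sup>2) / 2))"
proof -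
  have "char (centered_normal \<sigma>) u = char std_normal_distribution (\<sigma> * u)"
    unfolding char_def centered_normal_def by (subst integral_distr) (auto simp: mult_ac)
  then show ?thesis by (simp add: char_std_normal_distribution)
qed

lemma centered_normal_moments:
  shows "integrable (centered_normal \<sigma>) (\<lambda>x. x)" "(\<integral>x. x \<partial>centered_normal \<sigma>) = 0"
    "integrable (centered_normal \<sigma>) (\<lambda>x. x\<^sup>2)" "(\<integral>x. x\<^sup>2 \<partial>centered_normal \<sigma>) = \<sigma>\<^sup>2"
proof -
  have 1: "integrable std_normal_distribution (\<lambda>x. x)"
    by (rule integrable_std_normal_distribution_moment[of 1, unfolded power_one_right])
  have 2: "(\<integral>x. x \<partial>std_normal_distribution) = 0"
    by (rule integral_std_normal_distribution_moment_odd[OF odd_one, unfolded power_one_right])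
  have 3: "integrable std_normal_distribution (\<lambda>x. x\<^sup>2)"
    by (rule integrable_std_normal_distribution_moment)
  have 4: "(\<integral>x. x\<^sup>2 \<partial>std_normal_distribution) = 1"
    by (rule trans[OF std_normal_distribution_even_moments(1)[of 1, unfolded mult_1_right]]) simp
  show "integrable (centered_normal \<sigma>) (\<lambda>x. x)"
    unfolding centered_normal_def by (subst integrable_distr_eq) (simp, simp, intro integrable_mult_right 1)
  show "(\<integral>x. x \<partial>centered_normal \<sigma>) = 0"
    unfolding centered_normal_def by (subst integral_distr) (simp, simp, simp only: integral_mult_right_zero 2)
  show "integrable (centered_normal \<sigma>) (\<lambda>x. x\<^sup>2)"
    unfolding centered_normal_def by (subst integrable_distr_eq) (simp, simp, unfold power_mult_distrib, intro integrable_mult_right 3)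
  show "(\<integral>x. x\<^sup>2 \<partial>centered_normal \<sigma>) = \<sigma>\<^sup>2"
    unfolding centered_normal_def by (subst integral_distr) (simp, simp, simp only: power_mult_distrib integral_mult_right_zero 4 mult_1_right)
qed

lemma nn_integral_abs_centered_normal:
  assumes "0 \<le> \<sigma>"
  shows "(\<integral>\<^sup>+x. ennreal \<bar>x\<bar> \<partial>centered_normal \<sigma>) = ennreal (sqrt (2 / pi) * \<sigma>)"
proof -
  have "integrable std_normal_distribution (\<lambda>x. \<sigma> * \<bar>x\<bar>)"
    using integrable_std_normal_distribution_moment[of 1]
    by (intro integrable_mult_right integrable_abs) (simp only: power_one_right)
  moreover have "(\<integral>x. \<sigma> * \<bar>x\<bar> \<partial>std_normal_distribution) = sqrt (2 / pi) * \<sigma>"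
    using std_normal_distribution_odd_moments_abs[of 0]
    by (simp del: integral_density)
  ultimately have "(\<integral>\<^sup>+x. ennreal (\<sigma> * \<bar>x\<bar>) \<partial>std_normal_distribution) = ennreal (sqrt (2 / pi) * \<sigma>)"
    using assms by (subst nn_integral_eq_integral) auto
  then show ?thesis
    unfolding centered_normal_def using assms by (simp add: nn_integral_distr abs_mult)
qed

lemma gaussian_rvI:
  assumes "X \<in> borel_measurable M" "distr M borel X = centered_normal \<sigma>" "0 \<le> \<sigma>"
  shows "gaussian_rv M X"
  unfolding gaussian_rv_def using assms centered_normal_eq_density[OF assms(3)] by metis

locale std_normal_sequence = prob_space M for M :: "'w measure" +
  fixes \<xi> :: "nat \<Rightarrow> 'w \<Rightarrow> real"
  assumes indep: "indep_vars (\<lambda>_. borel) \<xi> UNIV"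
    and std_normal: "\<And>k. distr M borel (\<xi> k) = std_normal_distribution"
begin

lemma measurable_xi [measurable]: "\<xi> k \<in> borel_measurable M"
  using indep by (auto simp: indep_vars_def)

lemma char_partial_sum:
  assumes "finite I"
  shows "char (distr M borel (\<lambda>\<omega>. \<Sum>k\<in>I. b k * \<xi> k \<omega>)) u =
    complex_of_real (exp (- ((\<Sum>k\<in>I. (b k)\<^sup>2) * u\<^sup>2) / 2))"
proof -
  have "indep_vars (\<lambda>_. borel) (\<lambda>k \<omega>. b k * \<xi> k \<omega>) I"
    by (rule indep_vars_compose2[OF indep_vars_subset[OF indep]]) auto
  then have "char (distr M borel (\<lambda>\<omega>. \<Sum>k\<in>I. b k * \<xi> k \<omega>)) u =
      (\<Prod>k\<in>I. char (distr M borel (\<lambda>\<omega>. b k * \<xi> k \<omega>)) u)"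
    by (rule char_distr_sum)
  also have "\<dots> = (\<Prod>k\<in>I. complex_of_real (exp (- ((b k * u)\<^sup>2) / 2)))"
  proof (rule prod.cong[OF refl])
    fix k
    have "distr M borel (\<lambda>\<omega>. b k * \<xi> k \<omega>) = distr (distr M borel (\<xi> k)) borel (\<lambda>x. b k * x)"
      by (subst distr_distr) (auto simp: comp_def)
    then have "distr M borel (\<lambda>\<omega>. b k * \<xi> k \<omega>) = centered_normal (b k)"
      by (simp add: std_normal centered_normal_def)
    then show "char (distr M borel (\<lambda>\<omega>. b k * \<xi> k \<omega>)) u = complex_of_real (exp (- ((b k * u)\<^sup>2) / 2))"
      by (simp add: char_centered_normal)
  qed
  also have "\<dots> = complex_of_real (\<Prod>k\<in>I. exp (- ((b k * u)\<^sup>2) / 2))"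
    by simp
  also have "(\<Prod>k\<in>I. exp (- ((b k * u)\<^sup>2) / 2)) = exp (- ((\<Sum>k\<in>I. (b k)\<^sup>2) * u\<^sup>2) / 2)"
    using assms by (simp add: exp_sum[symmetric] sum_negf sum_divide_distrib sum_distrib_right power_mult_distrib)
  finally show ?thesis .
qed

lemma distr_partial_sum:
  assumes "finite I"
  shows "distr M borel (\<lambda>\<omega>. \<Sum>k\<in>I. b k * \<xi> k \<omega>) = centered_normal (sqrt (\<Sum>k\<in>I. (b k)\<^sup>2))"
proof (rule Levy_uniqueness[OF real_distribution_distr real_distribution_centered_normal])
  show "char (distr M borel (\<lambda>\<omega>. \<Sum>k\<in>I. b k * \<xi> k \<omega>)) = char (centered_normal (sqrt (\<Sum>k\<in>I. (b k)\<^sup>2)))"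
    using char_partial_sum[OF assms] by (simp add: fun_eq_iff char_centered_normal power_mult_distrib sum_nonneg)
qed simp

lemma nn_integral_abs_partial_sum:
  assumes "finite I"
  shows "(\<integral>\<^sup>+\<omega>. ennreal \<bar>\<Sum>k\<in>I. b k * \<xi> k \<omega>\<bar> \<partial>M) = ennreal (sqrt (2 / pi) * sqrt (\<Sum>k\<in>I. (b k)\<^sup>2))"
proof -
  have "(\<integral>\<^sup>+\<omega>. ennreal \<bar>\<Sum>k\<in>I. b k * \<xi> k \<omega>\<bar> \<partial>M)
      = (\<integral>\<^sup>+x. ennreal \<bar>x\<bar> \<partial>distr M borel (\<lambda>\<omega>. \<Sum>k\<in>I. b k * \<xi> k \<omega>))"
    by (simp add: nn_integral_distr)
  then show ?thesis
    by (simp add: distr_partial_sum[OF assms] nn_integral_abs_centered_normal sum_nonneg)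
qed

text \<open>Along an almost surely convergent subsequence the characteristic functions converge by bounded
  convergence, and they determine the law of the limit.\<close>

lemma distr_limit_partial_sums:
  assumes X [measurable]: "X \<in> borel_measurable M"
    and lim: "AE \<omega> in M. (\<lambda>j. \<Sum>k<\<nu> j. b k * \<xi> k \<omega>) \<longlonglongrightarrow> X \<omega>"
    and \<nu>: "filterlim \<nu> at_top sequentially" and b: "(\<lambda>k. (b k)\<^sup>2) sums (\<sigma>\<^sup>2)"
  shows "distr M borel X = centered_normal \<sigma>"
proof (rule Levy_uniqueness[OF real_distribution_distr[OF X] real_distribution_centered_normal], rule ext)
  fix u
  let ?S = "\<lambda>j \<omega>. \<Sum>k<\<nu> j. b k * \<xi> k \<omega>"
  have "(\<lambda>j. char (distr M borel (?S j)) u) \<longlonglongrightarrow> char (distr M borel X) u"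
  proof -
    have "(\<lambda>j. \<integral>\<omega>. iexp (u * ?S j \<omega>) \<partial>M) \<longlonglongrightarrow> (\<integral>\<omega>. iexp (u * X \<omega>) \<partial>M)"
    proof (rule integral_dominated_convergence[where w = "\<lambda>_. 1"])
      show "AE \<omega> in M. (\<lambda>j. iexp (u * ?S j \<omega>)) \<longlonglongrightarrow> iexp (u * X \<omega>)"
        using lim by eventually_elim (intro tendsto_intros)
    qed auto
    then show ?thesis by (simp add: char_def integral_distr)
  qed
  moreover have "(\<lambda>j. char (distr M borel (?S j)) u) \<longlonglongrightarrow> complex_of_real (exp (- (\<sigma>\<^sup>2 * u\<^sup>2) / 2))"
    unfolding char_partial_sum[OF finite_lessThan]
    by (intro tendsto_intros filterlim_compose[OF b[unfolded sums_def] \<nu>]) auto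
  ultimately show "char (distr M borel X) u = char (centered_normal \<sigma>) u"
    unfolding char_centered_normal power_mult_distrib by (rule LIMSEQ_unique)
qed

end

lemma centered_normal_law_moments:
  assumes [measurable]: "X \<in> borel_measurable M" and X: "distr M borel X = centered_normal \<sigma>"
  shows "integrable M X" "(\<integral>\<omega>. X \<omega> \<partial>M) = 0" "integrable M (\<lambda>\<omega>. (X \<omega>)\<^sup>2)" "(\<integral>\<omega>. (X \<omega>)\<^sup>2 \<partial>M) = \<sigma>\<^sup>2"
  using centered_normal_moments[of \<sigma>] unfolding X[symmetric]
  by (simp_all add: integrable_distr_eq integral_distr)

section \<open>Series of solutions of the heat equation\<close>

text \<open>Functions that are recovered at later times from each of their time slices. Unlike the heat equation this
  property passes to limits by dominated convergence; for slices that are integrable against the weight it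
  implies smoothness and the heat equation.\<close>

definition heat_evolution :: "((real^'n) \<times> real \<Rightarrow> real) \<Rightarrow> bool"
  where "heat_evolution u \<longleftrightarrow> (\<forall>t>0. (\<lambda>y. u (y, t)) \<in> borel_measurable borel \<and>
    (\<forall>s>0. \<forall>x. has_bochner_integral lborel (\<lambda>y. heat_kernel s (x - y) * u (y, t)) (u (x, s + t))))"

lemma heat_evolution_comb:
  assumes u: "heat_evolution u" and v: "heat_evolution v"
  shows "heat_evolution (\<lambda>p. c * u p + d * v p)"
  unfolding heat_evolution_def
proof (intro allI impI conjI)
  fix t :: real assume t: "0 < t"
  have [measurable]: "(\<lambda>y. u (y, t)) \<in> borel_measurable borel" "(\<lambda>y. v (y, t)) \<in> borel_measurable borel"
    using u v t by (auto simp: heat_evolution_def)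
  show "(\<lambda>y. c * u (y, t) + d * v (y, t)) \<in> borel_measurable borel" by measurable
  fix s :: real and x assume s: "0 < s"
  have "has_bochner_integral lborel
      (\<lambda>y. c * (heat_kernel s (x - y) * u (y, t)) + d * (heat_kernel s (x - y) * v (y, t)))
      (c * u (x, s + t) + d * v (x, s + t))"
    using u v t s unfolding heat_evolution_def
    by (intro has_bochner_integral_add has_bochner_integral_mult_right) blast+
  then show "has_bochner_integral lborel (\<lambda>y. heat_kernel s (x - y) * (c * u (y, t) + d * v (y, t)))
      (c * u (x, s + t) + d * v (x, s + t))"
    by (simp add: algebra_simps)
qed

lemma heat_evolution_zero: "heat_evolution (\<lambda>p. 0)"
  by (simp add: heat_evolution_def has_bochner_integral_zero)

lemma heat_evolution_sum:
  assumes "finite I" "\<And>i. i \<in> I \<Longrightarrow> heat_evolution (u i)"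
  shows "heat_evolution (\<lambda>p. \<Sum>i\<in>I. u i p * c i)"
  using assms
proof (induction I rule: finite_induct)
  case (insert i I)
  then show ?case
    using heat_evolution_comb[of "u i" "\<lambda>p. \<Sum>i\<in>I. u i p * c i" "c i" 1]
    by (simp add: mult.commute)
qed (simp add: heat_evolution_zero)

lemma heat_evolution_heat_cov:
  assumes "q \<in> D0"
  shows "heat_evolution (\<lambda>p. heat_cov p q)"
proof -
  have q: "0 < snd q" using assms by (auto simp: D0_def)
  then show ?thesis
    unfolding heat_evolution_def heat_cov_def
    using has_bochner_integral_heat_kernel_conv[of _ "_ + snd q" _ "fst q"]
    by (auto simp: add.assoc)
qed

text \<open>A single hypothesis on the slices controls everything: the norms \<open>N m j\<close> of the terms at \<open>slice_time m\<close> are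
  summable over \<open>j\<close>, the value of a term at a later point is at most a constant times \<open>N m j\<close>, and so
  the series converges absolutely on \<open>D0\<close> and may be integrated termwise against the heat kernel.\<close>

lemma heat_evolution_series:
  fixes A :: "nat \<Rightarrow> (real^'n) \<times> real \<Rightarrow> real"
  assumes A: "\<And>j. heat_evolution (A j)"
    and fin: "\<And>m. (\<Sum>j. \<integral>\<^sup>+y. ennreal (\<bar>A j (y, slice_time m)\<bar> * weight y) \<partial>lborel) < \<infinity>"
    and u: "\<And>p. p \<in> D0 \<Longrightarrow> u p = (\<Sum>j. A j p)"
  shows "p \<in> D0 \<Longrightarrow> summable (\<lambda>j. A j p)"
    and "weighted_integrable (\<lambda>y. u (y, slice_time m))"
    and "heat_represented (\<lambda>m y. u (y, slice_time m)) heat_kernel_pair u"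
proof -
  define N where "N m j = (\<integral>y. \<bar>A j (y, slice_time m)\<bar> * weight y \<partial>lborel)" for m j
  have meas [measurable]: "(\<lambda>y. A j (y, slice_time m)) \<in> borel_measurable borel" for j m
    using A[of j] by (simp add: heat_evolution_def)
  have int: "integrable lborel (\<lambda>y. \<bar>A j (y, slice_time m)\<bar> * weight y)" for j m
  proof (rule integrableI_nonneg)
    have "(\<integral>\<^sup>+y. ennreal (\<bar>A j (y, slice_time m)\<bar> * weight y) \<partial>lborel)
        \<le> (\<Sum>j. \<integral>\<^sup>+y. ennreal (\<bar>A j (y, slice_time m)\<bar> * weight y) \<partial>lborel)"
      using sum_le_suminf[of "\<lambda>j. \<integral>\<^sup>+y. ennreal (\<bar>A j (y, slice_time m)\<bar> * weight y) \<partial>lborel" "{j}"]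
      by simp
    then show "(\<integral>\<^sup>+y. ennreal (\<bar>A j (y, slice_time m)\<bar> * weight y) \<partial>lborel) < \<infinity>"
      using fin[of m] by (rule le_less_trans)
  qed auto
  have N: "(\<integral>\<^sup>+y. ennreal (\<bar>A j (y, slice_time m)\<bar> * weight y) \<partial>lborel) = ennreal (N m j)" for j m
    unfolding N_def by (rule nn_integral_eq_integral[OF int]) auto
  have N_nonneg: "0 \<le> N m j" for m j unfolding N_def by (intro integral_nonneg_AE) auto
  have N_summable: "summable (N m)" for m
    using fin[of m] unfolding N by (intro summable_suminf_not_top N_nonneg) auto
  have bound: "\<exists>C. (\<forall>y. \<bar>heat_kernel (t - slice_time m) (x - y)\<bar> \<le> C * weight y)"
    if "slice_time m < t" for m t and x :: "real^'n"
  proof -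
    have "(x, t - slice_time m) \<in> D0" using that by (simp add: D0_def)
    then obtain \<delta> C where "0 < \<delta>" "\<forall>q\<in>ball (x, t - slice_time m) \<delta>. \<forall>y. \<bar>heat_kernel_pair (fst q - y, snd q)\<bar> \<le> C * weight y"
      using heat_poly_locally_bounded[OF heat_poly.kernel] by metis
    then show ?thesis by (intro exI[of _ C]) (auto dest!: bspec[where x = "(x, t - slice_time m)"])
  qed
  have repr: "has_bochner_integral lborel
      (\<lambda>y. heat_kernel (t - slice_time m) (x - y) * A j (y, slice_time m)) (A j (x, t))"
    if "slice_time m < t" for m t x j
  proof -
    have "\<forall>s>0. has_bochner_integral lborel (\<lambda>y. heat_kernel s (x - y) * A j (y, slice_time m))
        (A j (x, s + slice_time m))"
      using A[of j] unfolding heat_evolution_def by simp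
    from this[rule_format, of "t - slice_time m"] that show ?thesis by simp
  qed
  have norm_le: "(\<integral>y. norm (heat_kernel (t - slice_time m) (x - y) * A j (y, slice_time m)) \<partial>lborel) \<le> C * N m j"
    if m: "slice_time m < t" and C: "\<forall>y. \<bar>heat_kernel (t - slice_time m) (x - y)\<bar> \<le> C * weight y"
    for m t x j C
  proof -
    have "(\<integral>y. norm (heat_kernel (t - slice_time m) (x - y) * A j (y, slice_time m)) \<partial>lborel)
        \<le> (\<integral>y. C * (\<bar>A j (y, slice_time m)\<bar> * weight y) \<partial>lborel)"
    proof (rule integral_mono)
      show "integrable lborel (\<lambda>y. norm (heat_kernel (t - slice_time m) (x - y) * A j (y, slice_time m)))"
        using repr[OF m] by (intro integrable_norm) (auto simp: has_bochner_integral_iff)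
      show "integrable lborel (\<lambda>y. C * (\<bar>A j (y, slice_time m)\<bar> * weight y))"
        by (intro integrable_mult_right int)
      fix y
      have "\<bar>heat_kernel (t - slice_time m) (x - y)\<bar> * \<bar>A j (y, slice_time m)\<bar>
          \<le> (C * weight y) * \<bar>A j (y, slice_time m)\<bar>"
        using C by (intro mult_right_mono) auto
      then show "norm (heat_kernel (t - slice_time m) (x - y) * A j (y, slice_time m))
          \<le> C * (\<bar>A j (y, slice_time m)\<bar> * weight y)"
        by (simp only: real_norm_def abs_mult mult_ac)
    qed
    then show ?thesis by (simp add: N_def)
  qed
  have norm_summable: "summable (\<lambda>j. norm (A j p))" if p: "p \<in> D0" for p
  proof -
    obtain m where m: "slice_time m < snd p" using p by (rule D0_slice_time_less)
    obtain C where C: "\<forall>y. \<bar>heat_kernel (snd p - slice_time m) (fst p - y)\<bar> \<le> C * weight y"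
      using bound[OF m] by blast
    have "norm (A j p) \<le> C * N m j" for j
    proof -
      have "A j p = (\<integral>y. heat_kernel (snd p - slice_time m) (fst p - y) * A j (y, slice_time m) \<partial>lborel)"
        using repr[OF m, of "fst p" j] by (simp add: has_bochner_integral_iff)
      then have "norm (A j p) \<le> (\<integral>y. norm (heat_kernel (snd p - slice_time m) (fst p - y) * A j (y, slice_time m)) \<partial>lborel)"
        by (simp only: integral_norm_bound)
      also have "\<dots> \<le> C * N m j" by (rule norm_le[OF m C])
      finally show ?thesis .
    qed
    then show ?thesis
      by (intro summable_comparison_test[OF _ summable_mult[OF N_summable[of m], of C]]) auto
  qed
  show "summable (\<lambda>j. A j p)" if "p \<in> D0"
    using norm_summable[OF that] by (rule summable_norm_cancel)
  have slice: "(y, slice_time m) \<in> D0" for y :: "real^'n" and m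
    by (simp add: D0_def)
  show "weighted_integrable (\<lambda>y. u (y, slice_time m))"
  proof -
    have "integrable lborel (\<lambda>y. \<Sum>j. weight y * A j (y, slice_time m))"
    proof (rule integrable_suminf)
      show "integrable lborel (\<lambda>y. weight y * A j (y, slice_time m))" for j
        by (rule Bochner_Integration.integrable_bound[OF int[of j m]]) (auto simp: abs_mult)
      show "AE y in lborel. summable (\<lambda>j. norm (weight y * A j (y, slice_time m)))"
        unfolding norm_mult by (intro AE_I2 summable_mult norm_summable slice)
      show "summable (\<lambda>j. \<integral>y. norm (weight y * A j (y, slice_time m)) \<partial>lborel)"
        using N_summable[of m] by (simp add: N_def[abs_def] abs_mult mult.commute)
    qed
    then show ?thesis
      unfolding weighted_integrable_def u[OF slice]
      by (simp only: suminf_mult[OF summable_norm_cancel[OF norm_summable[OF slice]]])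
  qed
  show "heat_represented (\<lambda>m y. u (y, slice_time m)) heat_kernel_pair u"
    unfolding heat_represented_def
  proof (intro allI impI)
    fix m and q :: "(real^'n) \<times> real" assume m: "slice_time m < snd q"
    then have q: "q \<in> D0"
      by (auto simp: D0_def mem_Times_iff intro: less_trans[OF slice_time_pos])
    obtain C where C: "\<forall>y. \<bar>heat_kernel (snd q - slice_time m) (fst q - y)\<bar> \<le> C * weight y"
      using bound[OF m] by blast
    let ?f = "\<lambda>j y. heat_kernel (snd q - slice_time m) (fst q - y) * A j (y, slice_time m)"
    have "(\<integral>y. (\<Sum>j. ?f j y) \<partial>lborel) = (\<Sum>j. \<integral>y. ?f j y \<partial>lborel)"
    proof (rule integral_suminf)
      show "integrable lborel (?f j)" for j
        using repr[OF m] by (auto simp: has_bochner_integral_iff)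
      show "AE y in lborel. summable (\<lambda>j. norm (?f j y))"
        unfolding norm_mult by (intro AE_I2 summable_mult norm_summable slice)
      show "summable (\<lambda>j. \<integral>y. norm (?f j y) \<partial>lborel)"
        by (intro summable_comparison_test[OF _ summable_mult[OF N_summable[of m], of C]])
          (use norm_le[OF m C] in \<open>auto intro!: exI[of _ 0]\<close>)
    qed
    also have "\<dots> = (\<Sum>j. A j q)"
      using repr[OF m, of "fst q"] by (simp add: has_bochner_integral_iff)
    also have "\<dots> = u q" by (rule u[OF q, symmetric])
    finally show "u q = kernel_ext heat_kernel_pair (\<lambda>y. u (y, slice_time m)) (fst q, snd q - slice_time m)"
      unfolding kernel_ext_def u[OF slice]
      by (simp only: fst_conv snd_conv suminf_mult[OF summable_norm_cancel[OF norm_summable[OF slice]]])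
  qed
qed

section \<open>Modes of the covariance\<close>

lemma continuous_on_heat_cov: 
  assumes "continuous_on A P" "continuous_on A Q" "\<And>r. r \<in> A \<Longrightarrow> P r \<in> D0" "\<And>r. r \<in> A \<Longrightarrow> Q r \<in> D0"
  shows "continuous_on A (\<lambda>r. heat_cov (P r) (Q r))"
proof -
  have "continuous_on A (\<lambda>r. heat_kernel_pair (fst (P r) - fst (Q r), snd (P r) + snd (Q r)))"
    by (rule continuous_on_compose2[OF continuous_on_heat_poly[OF heat_poly.kernel]])
      (use assms in \<open>auto intro!: continuous_intros add_pos_pos simp: D0_def mem_Times_iff\<close>)
  then show ?thesis by (simp add: heat_cov_def)
qed

text \<open>By continuity of the covariance, a dense sequence in \<open>D0\<close> is dense for the distance of the kernel.\<close>

theorem heat_cov_expansion: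
  obtains f :: "nat \<Rightarrow> (real^'n) \<times> real \<Rightarrow> real"
  where "\<forall>p\<in>D0. \<forall>q\<in>D0. (\<lambda>k. f k p * f k q) sums heat_cov p q" and "\<forall>k. heat_evolution (f k)"
proof -
  obtain D :: "((real^'n) \<times> real) set" where D: "countable D" "\<And>X. open X \<Longrightarrow> X \<noteq> {} \<Longrightarrow> \<exists>d\<in>D. d \<in> X"
    using countable_dense_setE by blast
  have "(0, 1) \<in> (D0 :: ((real^'n) \<times> real) set)" by (simp add: D0_def)
  then have "D \<inter> D0 \<noteq> {}" using D(2)[OF open_D0] by blast
  then obtain a :: "nat \<Rightarrow> (real^'n) \<times> real" where a: "range a = D \<inter> D0"
    using range_from_nat_into[of "D \<inter> D0"] D(1) countable_Int1 by metis
  have dense: "\<exists>j. kernel_dist2 heat_cov p (a j) < e" if p: "p \<in> D0" and e: "0 < e" for p e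
  proof -
    let ?X = "D0 \<inter> (\<lambda>q. kernel_dist2 heat_cov p q) -` {..<e}"
    have "continuous_on D0 (\<lambda>q. kernel_dist2 heat_cov p q)"
      unfolding kernel_dist2_def using p by (intro continuous_intros continuous_on_heat_cov)
    then have "open ?X" using open_D0 by (intro continuous_open_preimage) auto
    moreover have "p \<in> ?X" using p e by (simp add: kernel_dist2_def)
    ultimately obtain d where "d \<in> D" "d \<in> ?X" using D(2) by blast
    then have "d \<in> range a" using a by blast
    then show ?thesis using \<open>d \<in> ?X\<close> by auto
  qed
  have aD: "range a \<subseteq> D0" using a by blast
  show ?thesis
  proof (rule that[of "kernel_mode heat_cov a"])
    show "\<forall>p\<in>D0. \<forall>q\<in>D0. (\<lambda>k. kernel_mode heat_cov a k p * kernel_mode heat_cov a k q) sums heat_cov p q"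
      using psd_kernel_expansion[OF psd_kernel_heat_cov aD dense] by blast
    show "\<forall>k. heat_evolution (kernel_mode heat_cov a k)"
    proof (rule allI, rule kernel_mode_in_span[where S = D0 and P = heat_evolution])
      show "heat_evolution (\<lambda>p. heat_cov p q)" if "q \<in> D0" for q
        using that by (rule heat_evolution_heat_cov)
      show "heat_evolution (\<lambda>p. c * u p + d * v p)" if "heat_evolution u" "heat_evolution v" for u v c d
        using that by (rule heat_evolution_comb)
    qed (rule aD)
  qed
qed

section \<open>The random heat heat_field\<close>

lemma sum_consecutive_blocks:
  fixes t :: "nat \<Rightarrow> 'a::comm_monoid_add"
  assumes "mono \<nu>" "\<nu> 0 = 0"
  shows "(\<Sum>i<j. \<Sum>k\<in>{\<nu> i..<\<nu> (Suc i)}. t k) = (\<Sum>k<\<nu> j. t k)"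
proof (induction j)
  case (Suc j)
  have "\<nu> 0 \<le> \<nu> j" "\<nu> j \<le> \<nu> (Suc j)" using assms(1) by (auto simp: mono_def)
  then have "(\<Sum>k\<in>{0..<\<nu> j}. t k) + (\<Sum>k\<in>{\<nu> j..<\<nu> (Suc j)}. t k) = (\<Sum>k\<in>{0..<\<nu> (Suc j)}. t k)"
    by (intro sum.atLeastLessThan_concat) auto
  then show ?case using Suc by (simp add: lessThan_atLeast0)
qed (simp add: assms(2))

text \<open>The random series \<open>\<Sum>k. \<xi> k * f k p\<close> has the right covariance, but a priori it converges only in mean square
  at each point. Partial sums are therefore taken along a sequence \<open>cut j\<close> so sparse that the blocks in between
  have summable expected weighted \<open>L\<^sup>1\<close>-norm on every slice. Outside a null set the blocks then
  satisfy the hypothesis of \<open>heat_evolution_series\<close>.\<close>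

locale heat_modes = std_normal_sequence M \<xi> for M :: "'w measure" and \<xi> :: "nat \<Rightarrow> 'w \<Rightarrow> real" +
  fixes f :: "nat \<Rightarrow> (real^'n) \<times> real \<Rightarrow> real"
  assumes modes: "\<And>p q. p \<in> D0 \<Longrightarrow> q \<in> D0 \<Longrightarrow> (\<lambda>k. f k p * f k q) sums heat_cov p q"
    and evolution: "\<And>k. heat_evolution (f k)"
begin

text \<open>The variance at \<open>p\<close> of the series from index \<open>n\<close> on.\<close>

definition tail_var :: "nat \<Rightarrow> (real^'n) \<times> real \<Rightarrow> real"
  where "tail_var n p = heat_cov p p - (\<Sum>k<n. (f k p)\<^sup>2)"

lemma modes_power2: "p \<in> D0 \<Longrightarrow> (\<lambda>k. (f k p)\<^sup>2) sums heat_cov p p"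
  using modes[of p p] by (simp add: power2_eq_square)

lemma tail_var_bounds:
  assumes p: "p \<in> D0"
  shows "(\<Sum>k\<in>{n..<m}. (f k p)\<^sup>2) \<le> tail_var n p" and "0 \<le> tail_var n p" and "tail_var n p \<le> heat_cov p p"
    and "(\<lambda>n. tail_var n p) \<longlonglongrightarrow> 0"
proof -
  note s = modes_power2[OF p]
  have le: "(\<Sum>k<m. (f k p)\<^sup>2) \<le> heat_cov p p" for m
    using sum_le_suminf[OF sums_summable[OF s], of "{..<m}"] sums_unique[OF s] by simp
  show 0: "0 \<le> tail_var n p" using le[of n] by (simp add: tail_var_def)
  show "tail_var n p \<le> heat_cov p p" by (simp add: tail_var_def sum_nonneg)
  show "(\<lambda>n. tail_var n p) \<longlonglongrightarrow> 0"
    using tendsto_diff[OF tendsto_const s[unfolded sums_def], of "heat_cov p p"] by (simp add: tail_var_def)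
  show "(\<Sum>k\<in>{n..<m}. (f k p)\<^sup>2) \<le> tail_var n p"
  proof (cases "n \<le> m")
    case True
    then have "(\<Sum>k\<in>{0..<n}. (f k p)\<^sup>2) + (\<Sum>k\<in>{n..<m}. (f k p)\<^sup>2) = (\<Sum>k\<in>{0..<m}. (f k p)\<^sup>2)"
      by (intro sum.atLeastLessThan_concat) auto
    then show ?thesis using le[of m] by (simp add: tail_var_def lessThan_atLeast0)
  qed (use 0 in simp)
qed

definition slice_error :: "nat \<Rightarrow> nat \<Rightarrow> real"
  where "slice_error n m = (\<integral>y. sqrt (tail_var n (y, slice_time m)) * weight y \<partial>lborel)"

lemma slice_in_D0: "(y, slice_time m) \<in> D0"
  by (simp add: D0_def)

lemma measurable_mode_slice [measurable]: "(\<lambda>y. f k (y, slice_time m)) \<in> borel_measurable borel"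
  using evolution[of k] by (simp add: heat_evolution_def)

lemma heat_cov_diag: "heat_cov (y :: real^'n, t) (y, t) = heat_kernel (t + t) (0 :: real^'n)"
  by (simp add: heat_cov_def del: mult_2)

lemma measurable_tail_var [measurable]: "(\<lambda>y. tail_var n (y, slice_time m)) \<in> borel_measurable borel"
  unfolding tail_var_def heat_cov_diag by measurable

lemma integrable_slice_error: "integrable lborel (\<lambda>y. sqrt (tail_var n (y, slice_time m)) * weight y)"
  and slice_error_tendsto: "(\<lambda>n. slice_error n m) \<longlonglongrightarrow> 0"
proof -
  let ?s = "\<lambda>n y. sqrt (tail_var n (y, slice_time m)) * weight y"
  let ?c = "sqrt (heat_kernel (slice_time m + slice_time m) (0 :: real^'n))"
  have w: "integrable lborel (\<lambda>y. ?c * weight (y :: real^'n))"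
    by (intro integrable_mult_right integrable_weight)
  have le: "norm (?s n y) \<le> ?c * weight y" for n y
    using tail_var_bounds(2,3)[OF slice_in_D0, of n y m]
    by (simp only: real_norm_def abs_mult heat_cov_diag abs_of_nonneg weight_nonneg real_sqrt_ge_0_iff)
      (intro mult_right_mono real_sqrt_le_mono, auto)
  have s: "(\<lambda>n. ?s n y) \<longlonglongrightarrow> 0" for y
    using tendsto_mult[OF tendsto_real_sqrt[OF tail_var_bounds(4)[OF slice_in_D0, of y m]] tendsto_const[of "weight y"]]
    by simp
  have meas: "?s n \<in> borel_measurable lborel" for n by measurable
  show "integrable lborel (?s n)"
    by (rule Bochner_Integration.integrable_bound[OF w meas]) (use order_trans[OF le abs_ge_self] in auto)
  have "(\<lambda>n. integral\<^sup>L lborel (?s n)) \<longlonglongrightarrow> (\<integral>y. 0 \<partial>(lborel :: (real^'n) measure))"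
    by (rule integral_dominated_convergence[OF _ meas w]) (use s le in auto)
  then show "(\<lambda>n. slice_error n m) \<longlonglongrightarrow> 0" by (simp add: slice_error_def)
qed

lemma slice_error_nonneg: "0 \<le> slice_error n m"
  unfolding slice_error_def using tail_var_bounds(2)[OF slice_in_D0]
  by (intro integral_nonneg_AE AE_I2 mult_nonneg_nonneg) auto

text \<open>From index \<open>threshold j\<close> on the tails are small on the slices up to number \<open>j\<close> only, as infinitely many slices
  cannot be controlled at once. For a fixed slice this fails for finitely many \<open>j\<close>, which leaves
  summability intact.\<close>

definition threshold :: "nat \<Rightarrow> nat"
  where "threshold j = (SOME N. \<forall>n\<ge>N. \<forall>m\<le>j. slice_error n m \<le> (1 / 2) ^ j)"

lemma slice_error_threshold:
  assumes "threshold j \<le> n" "m \<le> j"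
  shows "slice_error n m \<le> (1 / 2) ^ j"
proof -
  have "\<forall>\<^sub>F n in sequentially. \<forall>m\<in>{..j}. slice_error n m < (1 / 2) ^ j"
    by (intro eventually_ball_finite ballI order_tendstoD(2)[OF slice_error_tendsto]) auto
  then have "\<exists>N. \<forall>n\<ge>N. \<forall>m\<le>j. slice_error n m \<le> (1 / 2) ^ j"
    unfolding eventually_sequentially by (meson atMost_iff less_imp_le)
  from someI_ex[OF this] show ?thesis using assms unfolding threshold_def by blast
qed

text \<open>Summing the thresholds gives a strictly increasing sequence that starts at \<open>0\<close> and is at least \<open>threshold j\<close> at
  index \<open>Suc j\<close>.\<close>

definition cut :: "nat \<Rightarrow> nat"
  where "cut j = j + (\<Sum>i<j. threshold i)"

lemma cut_0 [simp]: "cut 0 = 0"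
  by (simp add: cut_def)

lemma mono_cut: "mono cut"
  by (intro mono_iff_le_Suc[THEN iffD2]) (simp add: cut_def)

lemma filterlim_cut: "filterlim cut at_top sequentially"
  by (rule filterlim_at_top_mono[OF filterlim_ident]) (simp add: cut_def)

lemma slice_error_cut_summable: "summable (\<lambda>j. slice_error (cut j) m)"
proof (rule summable_comparison_test'[where N = "Suc m"])
  show "summable (\<lambda>j. 2 * (1 / 2 :: real) ^ j)"
    by (intro summable_mult summable_geometric) simp
  fix j assume "Suc m \<le> j"
  then obtain i where i: "j = Suc i" "m \<le> i" by (cases j) auto
  have "threshold i \<le> cut j" by (simp add: i cut_def)
  from slice_error_threshold[OF this i(2)] show "norm (slice_error (cut j) m) \<le> 2 * (1 / 2) ^ j"
    using slice_error_nonneg[of "cut j" m] by (simp add: i)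
qed

definition block :: "nat \<Rightarrow> 'w \<Rightarrow> (real^'n) \<times> real \<Rightarrow> real"
  where "block j \<omega> p = (\<Sum>k\<in>{cut j..<cut (Suc j)}. f k p * \<xi> k \<omega>)"

definition block_norm :: "nat \<Rightarrow> nat \<Rightarrow> 'w \<Rightarrow> ennreal"
  where "block_norm m j \<omega> = (\<integral>\<^sup>+y. ennreal (\<bar>block j \<omega> (y, slice_time m)\<bar> * weight y) \<partial>lborel)"

lemma measurable_block [measurable]: "(\<lambda>\<omega>. block j \<omega> p) \<in> borel_measurable M"
  unfolding block_def by measurable

lemma measurable_block_slice [measurable]:
  "(\<lambda>(\<omega>, y). block j \<omega> (y, slice_time m)) \<in> borel_measurable (M \<Otimes>\<^sub>M lborel)"
  unfolding block_def by measurable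

lemma measurable_block_norm [measurable]: "block_norm m j \<in> borel_measurable M"
  unfolding block_norm_def[abs_def] by measurable

text \<open>By Fubini the expectation may be taken pointwise first, where the block is a centered normal variable and its
  expected absolute value is \<open>sqrt (2 / pi)\<close> times its standard deviation.\<close>

lemma nn_integral_block_norm_le:
  "(\<integral>\<^sup>+\<omega>. block_norm m j \<omega> \<partial>M) \<le> ennreal (sqrt (2 / pi) * slice_error (cut j) m)"
proof -
  interpret pair_sigma_finite M "lborel :: (real^'n) measure" ..
  have "(\<integral>\<^sup>+\<omega>. block_norm m j \<omega> \<partial>M)
      = (\<integral>\<^sup>+y. (\<integral>\<^sup>+\<omega>. ennreal (\<bar>block j \<omega> (y, slice_time m)\<bar> * weight y) \<partial>M) \<partial>lborel)"
    unfolding block_norm_def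
    by (subst Fubini'[symmetric]) (auto simp: split_beta')
  also have "\<dots> \<le> (\<integral>\<^sup>+y. ennreal (sqrt (2 / pi) * (sqrt (tail_var (cut j) (y, slice_time m)) * weight y)) \<partial>lborel)"
  proof (rule nn_integral_mono)
    fix y :: "real^'n"
    let ?p = "(y, slice_time m)"
    have "(\<integral>\<^sup>+\<omega>. ennreal (\<bar>block j \<omega> ?p\<bar> * weight y) \<partial>M) = (\<integral>\<^sup>+\<omega>. ennreal \<bar>block j \<omega> ?p\<bar> \<partial>M) * ennreal (weight y)"
      by (simp add: ennreal_mult'' nn_integral_multc)
    also have "(\<integral>\<^sup>+\<omega>. ennreal \<bar>block j \<omega> ?p\<bar> \<partial>M) =
        ennreal (sqrt (2 / pi) * sqrt (\<Sum>k\<in>{cut j..<cut (Suc j)}. (f k ?p)\<^sup>2))"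
      unfolding block_def by (rule nn_integral_abs_partial_sum) simp
    also have "\<dots> * ennreal (weight y) \<le> ennreal (sqrt (2 / pi) * sqrt (tail_var (cut j) ?p)) * ennreal (weight y)"
      using tail_var_bounds(1)[OF slice_in_D0]
      by (intro mult_right_mono ennreal_leI mult_left_mono real_sqrt_le_mono) auto
    also have "\<dots> = ennreal (sqrt (2 / pi) * (sqrt (tail_var (cut j) ?p) * weight y))"
      by (simp add: ennreal_mult''[symmetric] mult.assoc)
    finally show "(\<integral>\<^sup>+\<omega>. ennreal (\<bar>block j \<omega> ?p\<bar> * weight y) \<partial>M)
        \<le> ennreal (sqrt (2 / pi) * (sqrt (tail_var (cut j) ?p) * weight y))" .
  qed
  also have "\<dots> = ennreal (sqrt (2 / pi) * slice_error (cut j) m)"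
    unfolding slice_error_def
    using tail_var_bounds(2)[OF slice_in_D0] integrable_slice_error
    by (subst nn_integral_eq_integral) auto
  finally show ?thesis .
qed

definition good :: "'w set"
  where "good = {\<omega> \<in> space M. \<forall>m. (\<Sum>j. block_norm m j \<omega>) < \<infinity>}"

lemma good_sets [measurable]: "good \<in> sets M"
  unfolding good_def by measurable

lemma AE_good: "AE \<omega> in M. \<omega> \<in> good"
proof -
  have "AE \<omega> in M. (\<Sum>j. block_norm m j \<omega>) \<noteq> \<infinity>" for m
  proof (rule nn_integral_PInf_AE)
    have "(\<integral>\<^sup>+\<omega>. (\<Sum>j. block_norm m j \<omega>) \<partial>M) = (\<Sum>j. \<integral>\<^sup>+\<omega>. block_norm m j \<omega> \<partial>M)"
      by (rule nn_integral_suminf) measurable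
    also have "\<dots> \<le> (\<Sum>j. ennreal (sqrt (2 / pi) * slice_error (cut j) m))"
      by (intro suminf_le nn_integral_block_norm_le) auto
    also have "\<dots> = ennreal (\<Sum>j. sqrt (2 / pi) * slice_error (cut j) m)"
      by (intro suminf_ennreal2 summable_mult slice_error_cut_summable) (simp add: slice_error_nonneg)
    finally show "(\<integral>\<^sup>+\<omega>. (\<Sum>j. block_norm m j \<omega>) \<partial>M) \<noteq> \<infinity>"
      by (auto simp: top_unique)
  qed measurable
  then have "AE \<omega> in M. \<forall>m. (\<Sum>j. block_norm m j \<omega>) \<noteq> \<infinity>" by (simp add: AE_all_countable)
  then show ?thesis
    using AE_space by eventually_elim (simp add: good_def less_top)
qed

text \<open>Off the good event every term is zero. The zero series satisfies the same hypotheses, so all path properties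
  hold everywhere and not just almost surely.\<close>

definition field_term :: "nat \<Rightarrow> 'w \<Rightarrow> (real^'n) \<times> real \<Rightarrow> real"
  where "field_term j \<omega> p = (if \<omega> \<in> good then block j \<omega> p else 0)"

definition heat_field :: "'w \<Rightarrow> (real^'n) \<times> real \<Rightarrow> real"
  where "heat_field \<omega> = restrict (\<lambda>p. \<Sum>j. field_term j \<omega> p) D0"

abbreviation field_slice :: "'w \<Rightarrow> nat \<Rightarrow> real^'n \<Rightarrow> real"
  where "field_slice \<omega> m y \<equiv> heat_field \<omega> (y, slice_time m)"

lemma field_series:
  shows "p \<in> D0 \<Longrightarrow> summable (\<lambda>j. field_term j \<omega> p)"
    and "weighted_integrable (field_slice \<omega> m)"
    and "heat_represented (field_slice \<omega>) heat_kernel_pair (heat_field \<omega>)"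
proof -
  have A: "heat_evolution (field_term j \<omega>)" for j
  proof (cases "\<omega> \<in> good")
    case True
    then have "field_term j \<omega> = (\<lambda>p. \<Sum>k\<in>{cut j..<cut (Suc j)}. f k p * \<xi> k \<omega>)"
      by (simp add: fun_eq_iff field_term_def block_def)
    then show ?thesis using heat_evolution_sum[of "{cut j..<cut (Suc j)}" f] evolution by simp
  next
    case False
    then have "field_term j \<omega> = (\<lambda>p. 0)" by (simp add: fun_eq_iff field_term_def)
    then show ?thesis by (simp add: heat_evolution_zero)
  qed
  have fin: "(\<Sum>j. \<integral>\<^sup>+y. ennreal (\<bar>field_term j \<omega> (y, slice_time m)\<bar> * weight y) \<partial>lborel) < \<infinity>" for m
  proof (cases "\<omega> \<in> good")
    case True
    then have "(\<Sum>j. block_norm m j \<omega>) < \<infinity>" by (simp add: good_def)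
    then show ?thesis using True by (simp add: field_term_def block_norm_def)
  qed (simp add: field_term_def)
  have u: "heat_field \<omega> p = (\<Sum>j. field_term j \<omega> p)" if "p \<in> D0" for p
    using that by (simp add: heat_field_def)
  note * = heat_evolution_series[of "\<lambda>j. field_term j \<omega>" "heat_field \<omega>", OF A fin u]
  show "p \<in> D0 \<Longrightarrow> summable (\<lambda>j. field_term j \<omega> p)" by (rule *(1))
  show "weighted_integrable (field_slice \<omega> m)" by (rule *(2))
  show "heat_represented (field_slice \<omega>) heat_kernel_pair (heat_field \<omega>)" by (rule *(3))
qed

lemma measurable_field_eval:
  assumes "p \<in> D0"
  shows "(\<lambda>\<omega>. heat_field \<omega> p) \<in> borel_measurable M"
proof -
  have "(\<lambda>\<omega>. \<Sum>j. field_term j \<omega> p) \<in> borel_measurable M"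
    unfolding field_term_def by measurable
  then show ?thesis using assms by (simp add: heat_field_def)
qed

lemma field_in_C21: "heat_field \<omega> \<in> C21"
  by (rule heat_represented_C21[OF field_series(3) heat_poly.kernel field_series(2)])
    (simp add: heat_field_def)

lemma measurable_field: "heat_field \<in> measurable M (borel_of_topology C21_topology)"
  by (intro measurable_borel_C21 field_in_C21 measurable_field_eval)

lemma field_partial_sums:
  assumes "\<omega> \<in> good" "p \<in> D0"
  shows "(\<lambda>j. \<Sum>k<cut j. f k p * \<xi> k \<omega>) \<longlonglongrightarrow> heat_field \<omega> p"
proof -
  have "(\<lambda>j. \<Sum>i<j. field_term i \<omega> p) \<longlonglongrightarrow> heat_field \<omega> p"
    using summable_LIMSEQ[OF field_series(1)[OF assms(2)]] assms(2) by (simp add: heat_field_def)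
  then show ?thesis
    using assms(1) by (simp add: field_term_def block_def sum_consecutive_blocks[OF mono_cut cut_0])
qed

text \<open>A finite combination of values of the field is itself a limit of partial sums, with coefficients \<open>b k\<close>
  in \<open>l\<^sup>2\<close>, and \<open>\<Sum>k. (b k)\<^sup>2\<close> is the quadratic form of the covariance. The points \<open>P i\<close> may coincide, so the
  covariance of a variable with itself is included.\<close>

theorem distr_field_combination:
  assumes I: "finite I" and P: "\<And>i. i \<in> I \<Longrightarrow> P i \<in> D0"
  shows "distr M borel (\<lambda>\<omega>. \<Sum>i\<in>I. c i * heat_field \<omega> (P i)) =
      centered_normal (sqrt (\<Sum>i\<in>I. \<Sum>j\<in>I. c i * c j * heat_cov (P i) (P j)))"
    and "0 \<le> (\<Sum>i\<in>I. \<Sum>j\<in>I. c i * c j * heat_cov (P i) (P j))"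
    and "(\<lambda>\<omega>. \<Sum>i\<in>I. c i * heat_field \<omega> (P i)) \<in> borel_measurable M"
proof -
  define b where "b k = (\<Sum>i\<in>I. c i * f k (P i))" for k
  let ?S = "\<Sum>i\<in>I. \<Sum>j\<in>I. c i * c j * heat_cov (P i) (P j)"
  have "(\<lambda>k. \<Sum>i\<in>I. \<Sum>j\<in>I. c i * c j * (f k (P i) * f k (P j))) sums ?S"
    by (intro sums_sum sums_mult modes P)
  moreover have "(\<Sum>i\<in>I. \<Sum>j\<in>I. c i * c j * (f k (P i) * f k (P j))) = (b k)\<^sup>2" for k
    by (simp add: b_def power2_eq_square sum_product mult_ac)
  ultimately have b: "(\<lambda>k. (b k)\<^sup>2) sums ?S" by simp
  then show nonneg: "0 \<le> ?S"
    using suminf_nonneg[OF sums_summable[OF b]] sums_unique[OF b] by simp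
  show meas: "(\<lambda>\<omega>. \<Sum>i\<in>I. c i * heat_field \<omega> (P i)) \<in> borel_measurable M"
    by (intro borel_measurable_sum borel_measurable_times measurable_field_eval P) auto
  show "distr M borel (\<lambda>\<omega>. \<Sum>i\<in>I. c i * heat_field \<omega> (P i)) = centered_normal (sqrt ?S)"
  proof (rule distr_limit_partial_sums[OF meas _ filterlim_cut])
    show "AE \<omega> in M. (\<lambda>j. \<Sum>k<cut j. b k * \<xi> k \<omega>) \<longlonglongrightarrow> (\<Sum>i\<in>I. c i * heat_field \<omega> (P i))"
      using AE_good
    proof eventually_elim
      case (elim \<omega>)
      have "(\<lambda>j. \<Sum>i\<in>I. c i * (\<Sum>k<cut j. f k (P i) * \<xi> k \<omega>)) \<longlonglongrightarrow> (\<Sum>i\<in>I. c i * heat_field \<omega> (P i))"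
        by (intro tendsto_sum tendsto_mult tendsto_const field_partial_sums elim P)
      moreover have "(\<Sum>i\<in>I. c i * (\<Sum>k<n. f k (P i) * \<xi> k \<omega>)) = (\<Sum>k<n. b k * \<xi> k \<omega>)" for n
        unfolding b_def sum_distrib_left sum_distrib_right
        by (subst sum.swap) (simp add: mult.assoc)
      ultimately show ?case by simp
    qed
    show "(\<lambda>k. (b k)\<^sup>2) sums (sqrt ?S)\<^sup>2" using b nonneg by simp
  qed
qed

lemma gaussian_field_field: "gaussian_field M D0 (\<lambda>p \<omega>. heat_field \<omega> p)"
  unfolding gaussian_field_def
proof (intro allI impI)
  fix F :: "((real^'n) \<times> real) set" and c assume "finite F" "F \<subseteq> D0"
  then show "gaussian_rv M (\<lambda>\<omega>. \<Sum>p\<in>F. c p * heat_field \<omega> p)"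
    using distr_field_combination[of F "\<lambda>p. p" c]
    by (intro gaussian_rvI[where \<sigma> = "sqrt (\<Sum>p\<in>F. \<Sum>q\<in>F. c p * c q * heat_cov p q)"]) auto
qed

lemma field_moments:
  assumes p: "p \<in> D0"
  shows "integrable M (\<lambda>\<omega>. heat_field \<omega> p)" "(\<integral>\<omega>. heat_field \<omega> p \<partial>M) = 0"
    "integrable M (\<lambda>\<omega>. (heat_field \<omega> p)\<^sup>2)" "(\<integral>\<omega>. (heat_field \<omega> p)\<^sup>2 \<partial>M) = heat_cov p p"
proof -
  note law = distr_field_combination[of "{()}" "\<lambda>_. p" "\<lambda>_. 1", simplified, OF p]
  note m = centered_normal_law_moments[OF measurable_field_eval[OF p] law(1)]
  show "integrable M (\<lambda>\<omega>. heat_field \<omega> p)" "(\<integral>\<omega>. heat_field \<omega> p \<partial>M) = 0"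
    "integrable M (\<lambda>\<omega>. (heat_field \<omega> p)\<^sup>2)" by (fact m)+
  show "(\<integral>\<omega>. (heat_field \<omega> p)\<^sup>2 \<partial>M) = heat_cov p p" unfolding m(4) using law(2) by simp
qed

text \<open>Polarization: the variances of the three Gaussian variables \<open>\<phi>(p)\<close>, \<open>\<phi>(q)\<close> and
  \<open>\<phi>(p) + \<phi>(q)\<close> determine the covariance.\<close>

lemma covariance_field:
  assumes p: "p \<in> D0" and q: "q \<in> D0"
  shows "covariance M (\<lambda>\<omega>. heat_field \<omega> p) (\<lambda>\<omega>. heat_field \<omega> q) = heat_cov p q"
proof -
  have sym: "heat_cov q p = heat_cov p q"
    by (rule psd_kernel_commute[OF psd_kernel_heat_cov q p])
  let ?P = "\<lambda>i::bool. if i then p else q"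
  have "(\<Sum>i\<in>UNIV. \<Sum>j\<in>UNIV. 1 * 1 * heat_cov (?P i) (?P j)) = heat_cov p p + 2 * heat_cov p q + heat_cov q q"
    by (simp add: UNIV_bool sym)
  moreover have "(\<Sum>i\<in>UNIV. 1 * heat_field \<omega> (?P i)) = heat_field \<omega> p + heat_field \<omega> q" for \<omega>
    by (simp add: UNIV_bool)
  ultimately have *: "integrable M (\<lambda>\<omega>. (heat_field \<omega> p + heat_field \<omega> q)\<^sup>2)"
    "(\<integral>\<omega>. (heat_field \<omega> p + heat_field \<omega> q)\<^sup>2 \<partial>M) = heat_cov p p + 2 * heat_cov p q + heat_cov q q"
    using distr_field_combination[of UNIV ?P "\<lambda>_. 1"] p q
      centered_normal_law_moments(3,4)[of "\<lambda>\<omega>. heat_field \<omega> p + heat_field \<omega> q" M]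
    by auto
  have "(\<integral>\<omega>. heat_field \<omega> p * heat_field \<omega> q \<partial>M)
      = (\<integral>\<omega>. ((heat_field \<omega> p + heat_field \<omega> q)\<^sup>2 - (heat_field \<omega> p)\<^sup>2 - (heat_field \<omega> q)\<^sup>2) / 2 \<partial>M)"
    by (intro Bochner_Integration.integral_cong refl) (simp add: power2_eq_square field_simps)
  also have "\<dots> = heat_cov p q"
    using * field_moments[OF p] field_moments[OF q] by simp
  finally show ?thesis
    by (simp add: covariance_def field_moments[OF p] field_moments[OF q])
qed

end

lemma indep_vars_PiM_coordinates:
  assumes S: "prob_space S" and h: "inj h"
  shows "prob_space.indep_vars (PiM UNIV (\<lambda>_::'i. S)) (\<lambda>_. S) (\<lambda>k \<omega>. \<omega> (h k)) (UNIV :: 'k set)"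
proof -
  interpret P: prob_space "PiM UNIV (\<lambda>_::'i. S)" by (rule prob_space_PiM) (rule S)
  have "distr (PiM UNIV (\<lambda>_::'i. S)) S (\<lambda>\<omega>. \<omega> (h k)) = S" for k
    using distr_PiM_component[of UNIV "\<lambda>_. S" "h k"] S by simp
  moreover have "distr (PiM UNIV (\<lambda>_::'i. S)) (PiM UNIV (\<lambda>_::'k. S)) (\<lambda>\<omega>. \<lambda>k\<in>UNIV. \<omega> (h k)) = PiM UNIV (\<lambda>_. S)"
    using distr_PiM_reindex[of UNIV "\<lambda>_. S" h UNIV] S h by simp
  ultimately show ?thesis
    by (subst P.indep_vars_iff_distr_eq_PiM') simp_all
qed

lemma std_normal_sequence_PiM:
  assumes h: "inj h"
  shows "std_normal_sequence (PiM UNIV (\<lambda>_::'i. std_normal_distribution)) (\<lambda>k \<omega>. \<omega> (h k))"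
proof -
  interpret S: real_distribution std_normal_distribution by (rule real_dist_normal_dist)
  interpret P: prob_space "PiM UNIV (\<lambda>_::'i. std_normal_distribution)"
    by (rule prob_space_PiM) (rule S.prob_space_axioms)
  show ?thesis
  proof
    have "P.indep_vars (\<lambda>_. std_normal_distribution) (\<lambda>k \<omega>. \<omega> (h k)) UNIV"
      by (rule indep_vars_PiM_coordinates[OF S.prob_space_axioms h])
    then have "P.indep_vars (\<lambda>_. borel) (\<lambda>k \<omega>. id (\<omega> (h k))) UNIV"
      by (rule P.indep_vars_compose2) simp
    then show "P.indep_vars (\<lambda>_. borel) (\<lambda>k \<omega>. \<omega> (h k)) UNIV" by simp
    show "distr (PiM UNIV (\<lambda>_::'i. std_normal_distribution)) borel (\<lambda>\<omega>. \<omega> (h k)) = std_normal_distribution" for k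
      using distr_PiM_component[of UNIV "\<lambda>_::'i. std_normal_distribution" "h k"] S.prob_space_axioms
      by (simp cong: distr_cong)
  qed
qed

text \<open>The sample space carries one independent standard normal variable for each point of space-time; the
  countably many at the points \<open>(0, k)\<close> drive the series.\<close>

theorem theorem1p5:
  shows "\<exists>(M :: ((real^'n) \<times> real \<Rightarrow> real) measure)
          (\<phi> :: ((real^'n) \<times> real \<Rightarrow> real) \<Rightarrow> ((real^'n) \<times> real \<Rightarrow> real)).
    prob_space M \<and>
    \<phi> \<in> measurable M (borel_of_topology C21_topology) \<and>
    gaussian_field M D0 (\<lambda>p \<omega>. \<phi> \<omega> p) \<and>
    centered_field M D0 (\<lambda>p \<omega>. \<phi> \<omega> p) \<and>
    (\<forall>x1 x2 t s. 0 < t \<longrightarrow> 0 < s \<longrightarrow>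
       covariance M (\<lambda>\<omega>. \<phi> \<omega> (x1, t)) (\<lambda>\<omega>. \<phi> \<omega> (x2, s)) = heat_kernel (s + t) (x1 - x2)) \<and>
    (\<forall>\<omega>\<in>space M.
       (\<forall>p\<in>D0. partial e_time (\<phi> \<omega>) p = laplacian_x (\<phi> \<omega>) p) \<and>
       Cinf_on D0 (\<phi> \<omega>) \<and>
       (\<forall>t1 t2 x. 0 < t1 \<longrightarrow> t1 < t2 \<longrightarrow>
          has_bochner_integral lborel (\<lambda>y. heat_kernel (t2 - t1) (x - y) * \<phi> \<omega> (y, t1))
            (\<phi> \<omega> (x, t2))))"
proof -
  define M where "M = PiM (UNIV :: ((real^'n) \<times> real) set) (\<lambda>_. std_normal_distribution)"
  define \<xi> :: "nat \<Rightarrow> ((real^'n) \<times> real \<Rightarrow> real) \<Rightarrow> real" where "\<xi> k \<omega> = \<omega> (0, real k)" for k \<omega>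
  obtain f :: "nat \<Rightarrow> (real^'n) \<times> real \<Rightarrow> real" where f:
    "\<forall>p\<in>D0. \<forall>q\<in>D0. (\<lambda>k. f k p * f k q) sums heat_cov p q" "\<forall>k. heat_evolution (f k)"
    by (rule heat_cov_expansion)
  interpret std_normal_sequence M \<xi>
    unfolding M_def \<xi>_def[abs_def] by (rule std_normal_sequence_PiM) (simp add: inj_def)
  interpret heat_modes M \<xi> f by unfold_locales (use f in auto)
  show ?thesis
  proof (intro exI[of _ M] exI[of _ heat_field] conjI ballI allI impI)
    show "prob_space M" by (rule prob_space_axioms)
    show "heat_field \<in> measurable M (borel_of_topology C21_topology)" by (rule measurable_field)
    show "gaussian_field M D0 (\<lambda>p \<omega>. heat_field \<omega> p)" by (rule gaussian_field_field)
    show "centered_field M D0 (\<lambda>p \<omega>. heat_field \<omega> p)"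
      unfolding centered_field_def using field_moments by blast
    show "covariance M (\<lambda>\<omega>. heat_field \<omega> (x1, t)) (\<lambda>\<omega>. heat_field \<omega> (x2, s)) = heat_kernel (s + t) (x1 - x2)"
      if "0 < t" "0 < s" for x1 x2 t s
      using covariance_field[of "(x1, t)" "(x2, s)"] that by (simp add: D0_def heat_cov_def add.commute)
    show "partial e_time (heat_field \<omega>) p = laplacian_x (heat_field \<omega>) p" if "p \<in> D0" for \<omega> p
      by (rule heat_represented_heat_equation[OF field_series(3,2) that])
    show "Cinf_on D0 (heat_field \<omega>)" for \<omega>
      unfolding Cinf_on_def using heat_represented_Ck_on[OF field_series(3) heat_poly.kernel field_series(2)] by blast
    show "has_bochner_integral lborel (\<lambda>y. heat_kernel (t2 - t1) (x - y) * heat_field \<omega> (y, t1)) (heat_field \<omega> (x, t2))"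
      if "0 < t1" "t1 < t2" for \<omega> t1 t2 x
      by (rule heat_represented_semigroup[OF field_series(3,2) that])
  qed
qed

end
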